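(* For every $n\geq 2$, $\mathrm{p}(A,C_n)\geq |\phi_2(n)|$, where $\phi_2(n)=\{k\mid 0\leq k\leq n-1,\ \gcd(k,n)=2^w \text{ for some } w\geq 0\}$. Equivalently, $\operatorname{GKdim}\big((A\#C_n)/(e_0)\big)\leq n-|\phi_2(n)|$.
   Context: $\Bbbk$ is an algebraically closed field of characteristic zero and $n\ge 2$. $A=\Bbbk_{-1}[x_0,\dots,x_{n-1}]$ is generated by degree-one $x_0,\dots,x_{n-1}$ with $x_ix_j=-x_jx_i$ ($i\neq j$); $C_n=\langle\sigma\rangle$ acts by $\sigma(x_i)=x_{i+1}$ (indices in $\mathbb{Z}_n$). $A\#C_n$ is the skew group algebra, $e_0=1\#\frac1n\sum_{g\in C_n}g$, $(e_0)$ the two-sided ideal it generates, and $\mathrm{p}(A,C_n)=\operatorname{GKdim}A-\operatorname{GKdim}\big((A\#C_n)/(e_0)\big)$. Here $\gcd(0,n)=n$. *)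

theory Defs
  imports Complex_Main "HOL-Library.Extended_Real" "HOL-Library.Liminf_Limsup" "HOL-Computational_Algebra.Polynomial"
begin

text \<open>
  Concrete model of the skew group algebra A # C_n, where
  A = k_{-1}[x_0,...,x_{n-1}] and sigma(x_i) = x_{i+1} (indices mod n).
  A k-basis of A # C_n is given by x^a # sigma^g, where x^a is the ordered monomial
  x_0^{a_0} x_1^{a_1} ... x_{n-1}^{a_{n-1}} (a : nat => nat, a i = 0 for i >= n),
  and 0 <= g < n.  Elements are finitely supported functions from keys (a, g) to k.
\<close>

type_synonym key = "(nat \<Rightarrow> nat) \<times> nat"
type_synonym 'a elt = "key \<Rightarrow> 'a"

definition algebraically_closed :: "'a::field itself \<Rightarrow> bool" where
  "algebraically_closed _ \<longleftrightarrow> (\<forall>p :: 'a poly. degree p > 0 \<longrightarrow> (\<exists>x. poly p x = 0))"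

definition valid_key :: "nat \<Rightarrow> key \<Rightarrow> bool" where
  "valid_key n k \<longleftrightarrow> (\<forall>i\<ge>n. fst k i = 0) \<and> snd k < n"

definition supp :: "'a::zero elt \<Rightarrow> key set" where
  "supp f = {k. f k \<noteq> 0}"

definition carrier_sk :: "nat \<Rightarrow> 'a::zero elt set" where
  "carrier_sk n = {f. finite (supp f) \<and> supp f \<subseteq> {k. valid_key n k}}"

definition basis_el :: "key \<Rightarrow> 'a::{zero,one} elt" where
  "basis_el k = (\<lambda>k'. if k' = k then 1 else 0)"

text \<open>exponent vector of sigma^g(x^b): sigma^g sends x_j to x_{j+g}\<close>
definition shift :: "nat \<Rightarrow> nat \<Rightarrow> (nat \<Rightarrow> nat) \<Rightarrow> (nat \<Rightarrow> nat)" where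
  "shift n g b = (\<lambda>i. if i < n then b ((i + n - g mod n) mod n) else 0)"

text \<open>sign from reordering x_g^{b_0} x_{g+1}^{b_1} ... x_{g+n-1}^{b_{n-1}} into ordered form\<close>
definition act_sign :: "nat \<Rightarrow> nat \<Rightarrow> (nat \<Rightarrow> nat) \<Rightarrow> int" where
  "act_sign n g b = (-1) ^ (\<Sum>j<n. \<Sum>j'<n.
      if j < j' \<and> (j + g) mod n > (j' + g) mod n then b j * b j' else 0)"

text \<open>x^a x^c = mon_sign * x^{a+c}\<close>
definition mon_sign :: "nat \<Rightarrow> (nat \<Rightarrow> nat) \<Rightarrow> (nat \<Rightarrow> nat) \<Rightarrow> int" where
  "mon_sign n a c = (-1) ^ (\<Sum>i<n. \<Sum>j<n. if j < i then a i * c j else 0)"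

text \<open>(x^a # sigma^g)(x^b # sigma^h) = x^a sigma^g(x^b) # sigma^{g+h}\<close>
definition key_mult :: "nat \<Rightarrow> key \<Rightarrow> key \<Rightarrow> key" where
  "key_mult n k1 k2 = ((\<lambda>i. fst k1 i + shift n (snd k1) (fst k2) i), (snd k1 + snd k2) mod n)"

definition key_sign :: "nat \<Rightarrow> key \<Rightarrow> key \<Rightarrow> int" where
  "key_sign n k1 k2 = act_sign n (snd k1) (fst k2) * mon_sign n (fst k1) (shift n (snd k1) (fst k2))"

definition sk_mult :: "nat \<Rightarrow> 'a::field elt \<Rightarrow> 'a elt \<Rightarrow> 'a elt" where
  "sk_mult n f h = (\<lambda>k. \<Sum>p \<in> supp f \<times> supp h.
      if key_mult n (fst p) (snd p) = k
      then of_int (key_sign n (fst p) (snd p)) * f (fst p) * h (snd p) else 0)"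

definition sk_one :: "'a::field elt" where
  "sk_one = basis_el ((\<lambda>_. 0), 0)"

definition e0 :: "nat \<Rightarrow> 'a::field elt" where
  "e0 n = (\<lambda>k. if fst k = (\<lambda>_. 0) \<and> snd k < n then 1 / of_nat n else 0)"

definition lin_span :: "'a::field elt set \<Rightarrow> 'a elt set" where
  "lin_span S = {f. \<exists>B c. finite B \<and> B \<subseteq> S \<and> f = (\<lambda>k. \<Sum>b\<in>B. c b * b k)}"

definition ideal_e0 :: "nat \<Rightarrow> 'a::field elt set" where
  "ideal_e0 n = lin_span {sk_mult n (sk_mult n r (e0 n)) s | r s. r \<in> carrier_sk n \<and> s \<in> carrier_sk n}"

definition word_prod :: "nat \<Rightarrow> 'a::field elt list \<Rightarrow> 'a elt" where
  "word_prod n ws = foldr (sk_mult n) ws sk_one"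

text \<open>V^m for V = span G (G contains 1)\<close>
definition filt_pow :: "nat \<Rightarrow> 'a::field elt set \<Rightarrow> nat \<Rightarrow> 'a elt set" where
  "filt_pow n G m = lin_span {word_prod n ws | ws. length ws = m \<and> set ws \<subseteq> G}"

definition indep_mod :: "'a::field elt set \<Rightarrow> 'a elt set \<Rightarrow> bool" where
  "indep_mod I B \<longleftrightarrow> (\<forall>c. (\<lambda>k. \<Sum>b\<in>B. c b * b k) \<in> I \<longrightarrow> (\<forall>b\<in>B. c b = 0))"

definition rank_mod :: "'a::field elt set \<Rightarrow> 'a elt set \<Rightarrow> nat" where
  "rank_mod I S = Sup {card B | B. finite B \<and> B \<subseteq> S \<and> indep_mod I B}"

text \<open>GKdim of R/I, R generated by G (a finite generating set containing 1):
  limsup_m log_m dim((V^m + I)/I)\<close>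
definition GKdim_quot :: "nat \<Rightarrow> 'a::field elt set \<Rightarrow> 'a elt set \<Rightarrow> ereal" where
  "GKdim_quot n G I = limsup (\<lambda>m. ereal (ln (real (rank_mod I (filt_pow n G m))) / ln (real m)))"

definition var_exp :: "nat \<Rightarrow> nat \<Rightarrow> nat" where
  "var_exp i = (\<lambda>j. if j = i then 1 else 0)"

definition gens_skew :: "nat \<Rightarrow> 'a::field elt set" where
  "gens_skew n = {basis_el ((\<lambda>_. 0), g) | g. g < n} \<union> {basis_el (var_exp i, 0) | i. i < n}"

text \<open>generators of A (embedded as the keys with g = 0): 1 and x_i\<close>
definition gens_A :: "nat \<Rightarrow> 'a::field elt set" where
  "gens_A n = {sk_one} \<union> {basis_el (var_exp i, 0) | i. i < n}"

definition GKdim_A :: "'a::field itself \<Rightarrow> nat \<Rightarrow> ereal" where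
  "GKdim_A _ n = GKdim_quot n (gens_A n :: 'a elt set) {\<lambda>_. 0}"

definition GKdim_skew_quot :: "'a::field itself \<Rightarrow> nat \<Rightarrow> ereal" where
  "GKdim_skew_quot _ n = GKdim_quot n (gens_skew n :: 'a elt set) (ideal_e0 n)"

definition pertinency :: "'a::field itself \<Rightarrow> nat \<Rightarrow> ereal" where
  "pertinency K n = GKdim_A K n - GKdim_skew_quot K n"

definition phi2 :: "nat \<Rightarrow> nat set" where
  "phi2 n = {k. k \<le> n - 1 \<and> (\<exists>w::nat. gcd k n = 2 ^ w)}"

end

theory Submission
  imports Defs "HOL-Library.Function_Algebras" "HOL-Library.FuncSet"
    "HOL-Number_Theory.Cong"
    "HOL-Real_Asymp.Real_Asymp"
begin

text \<open>
  Let \<open>w\<close> be a primitive \<open>n\<close>-th root of unity and put \<open>b\<^sub>j = \<Sum>\<^sub>i w\<^sup>i\<^sup>j x\<^sub>i\<close>,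
  \<open>c\<^sub>k = \<Sum>\<^sub>i w\<^sup>i\<^sup>k x\<^sub>i\<^sup>2\<close>, and let \<open>e\<^sub>r\<close> be the idempotents of the characters of the cyclic group.
  Then \<open>b\<^sub>i b\<^sub>j + b\<^sub>j b\<^sub>i = 2 c\<^sub>i\<^sub>+\<^sub>j\<close>, the \<open>c\<^sub>k\<close> commute with everything in \<open>A\<close>, and
  \<open>b\<^sub>j e\<^sub>r = e\<^sub>r\<^sub>+\<^sub>j b\<^sub>j\<close>, \<open>c\<^sub>k e\<^sub>r = e\<^sub>r\<^sub>+\<^sub>k c\<^sub>k\<close>.

  Fix \<open>k\<close> and call a residue \<open>r\<close> good if \<open>c\<^sub>k\<^sup>m e\<^sub>r\<close> lies in the ideal \<open>(e\<^sub>0)\<close> for some \<open>m\<close>.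
  Zero is good, goodness is invariant under adding \<open>k\<close>, and if \<open>i + j = k\<close> and \<open>r + i\<close>, \<open>r + j\<close> are
  good, so is \<open>r\<close>, because \<open>2 c\<^sub>k = b\<^sub>i b\<^sub>j + b\<^sub>j b\<^sub>i\<close>. With \<open>i = r\<close> and \<open>j = k - r\<close> this says that
  \<open>r\<close> is good as soon as \<open>2 r\<close> is. If \<open>gcd k n\<close> is a power of two, some \<open>2\<^sup>v r\<close> is a multiple
  of \<open>k\<close> modulo \<open>n\<close>, so every residue is good and \<open>c\<^sub>k\<close> is nilpotent modulo \<open>(e\<^sub>0)\<close>.

  The skew group algebra is finitely generated as a module over the polynomial ring in
  \<open>c\<^sub>0, \<dots>, c\<^sub>n\<^sub>-\<^sub>1\<close>, hence the quotient has growth at most \<open>m\<close> to the power of the number of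
  indices outside \<open>phi2 n\<close>.
\<close>

section \<open>Primitive roots of unity\<close>

definition primitive_root_of_unity :: "nat \<Rightarrow> 'a::field \<Rightarrow> bool" where
  "primitive_root_of_unity n w \<longleftrightarrow> (\<forall>j. w ^ j = 1 \<longleftrightarrow> n dvd j)"

text \<open>Any root of 1 + t + ... + t^(p-1) will do. It differs from 1, where this polynomial
  takes the value p, nonzero in characteristic zero; its order then divides p, and Bezout excludes
  every exponent coprime to p.\<close>

lemma prime_order_root_of_unity_exists:
  assumes ac: "algebraically_closed TYPE('a::field_char_0)" and p: "prime (p::nat)"
  shows "\<exists>z::'a. primitive_root_of_unity p z"
proof -
  define q :: "'a poly" where "q = (\<Sum>i<p. monom 1 i)"
  have p2: "p \<ge> 2" using p by (rule prime_ge_2_nat)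
  have "coeff q (p - 1) = 1"
    using p2 by (simp add: q_def coeff_sum coeff_monom)
  then have "degree q \<ge> p - 1" by (intro le_degree) simp
  then have "degree q > 0" using p2 by simp
  then obtain z where "poly q z = 0"
    using ac by (auto simp: algebraically_closed_def)
  then have z: "(\<Sum>i<p. z ^ i) = 0" by (simp add: q_def poly_sum poly_monom)
  have z1: "z \<noteq> 1" using z p2 by auto
  have zp: "z ^ p = 1" using z z1 by (simp add: geometric_sum)
  have "p dvd j" if j: "z ^ j = 1" for j
  proof (rule ccontr)
    assume "\<not> p dvd j"
    then have "coprime j p" using p by (metis coprime_commute prime_imp_coprime)
    moreover have "j \<noteq> 0" using \<open>\<not> p dvd j\<close> by (metis dvd_0_right)
    ultimately obtain x y where "j * x = p * y + 1"
      using bezout_nat[of j p] by auto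
    then have "z ^ (j * x) = z ^ (p * y + 1)" by simp
    then show False using j zp z1 by (simp add: power_mult power_add)
  qed
  then show ?thesis using zp
    by (intro exI[of _ z]) (auto simp: primitive_root_of_unity_def power_mult elim!: dvdE)
qed

text \<open>Induction that splits off a prime: n = p m. If p divides m, a p-th root of a primitive
  m-th root has order n; otherwise a root of order p is multiplied in, and coprime orders
  multiply.\<close>

lemma primitive_root_of_unity_exists:
  assumes ac: "algebraically_closed TYPE('a::field_char_0)" and "n > 0"
  shows "\<exists>w::'a. primitive_root_of_unity n w"
  using \<open>n > 0\<close>
proof (induction n rule: less_induct)
  case (less n)
  show ?case
  proof (cases "n = 1")
    case True
    then show ?thesis by (intro exI[of _ 1]) (simp add: primitive_root_of_unity_def)
  next
    case False
    then obtain p where p: "prime p" "p dvd n" using prime_factor_nat by blast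
    then obtain m where n: "n = p * m" by blast
    have p2: "p \<ge> 2" using p prime_ge_2_nat by blast
    have "m > 0" "m < n" using less.prems n p2 by auto
    then obtain w :: 'a where w: "\<And>j. w ^ j = 1 \<longleftrightarrow> m dvd j"
      using less.IH by (auto simp: primitive_root_of_unity_def)
    show ?thesis
    proof (cases "p dvd m")
      case True
      define q :: "'a poly" where "q = monom 1 p - [:w:]"
      have "coeff q p = 1" using p2 by (simp add: q_def coeff_pCons split: nat.split)
      then have "degree q \<ge> p" by (intro le_degree) simp
      then have "degree q > 0" using p2 by simp
      then obtain x where "poly q x = 0" using ac by (auto simp: algebraically_closed_def)
      then have x: "x ^ p = w" by (simp add: q_def poly_monom)
      obtain l where l: "m = p * l" using True by blast
      have "n dvd j" if j: "x ^ j = 1" for j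
      proof -
        have "w ^ j = 1" using j x by (metis mult.commute power_mult power_one)
        then obtain t where t: "j = m * t" using w by blast
        \<comment> \<open>From j = m t = p l t the power p can be absorbed into x ^ p = w;
          cancelling l in m dvd l t then leaves p dvd t.\<close>
        have "x ^ j = w ^ (l * t)" by (simp add: t l x[symmetric] power_mult)
        then have "m dvd l * t" using j w by auto
        then have "p dvd t" using \<open>m > 0\<close> by (simp add: l)
        then show ?thesis by (simp add: n t)
      qed
      moreover have "x ^ n = 1" using w[of m] by (simp add: n power_mult x)
      ultimately show ?thesis
        by (intro exI[of _ x]) (auto simp: primitive_root_of_unity_def power_mult dvd_def)
    next
      case False
      then have cop: "coprime p m" using p prime_imp_coprime by blast
      obtain z :: 'a where z: "\<And>j. z ^ j = 1 \<longleftrightarrow> p dvd j"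
        using prime_order_root_of_unity_exists[OF ac p(1)]
        by (auto simp: primitive_root_of_unity_def)
      have "n dvd j" if j: "(w * z) ^ j = 1" for j
      proof -
        \<comment> \<open>The p-th power removes z and isolates a condition on w alone.\<close>
        have "1 = ((w * z) ^ j) ^ p" using j by simp
        also have "\<dots> = w ^ (j * p) * z ^ (j * p)"
          by (simp add: power_mult_distrib power_mult)
        also have "z ^ (j * p) = 1" using z by simp
        finally have "m dvd j * p" using w by simp
        then have "m dvd j" using cop by (simp add: coprime_commute coprime_dvd_mult_left_iff)
        then have "w ^ j = 1" using w by simp
        then have "p dvd j" using j z by (simp add: power_mult_distrib)
        then show ?thesis using \<open>m dvd j\<close> cop by (simp add: n divides_mult)
      qed
      moreover have "(w * z) ^ j = 1" if "n dvd j" for j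
        using that w[of j] z[of j] by (auto simp: n power_mult_distrib)
      ultimately show ?thesis
        by (intro exI[of _ "w * z"]) (auto simp: primitive_root_of_unity_def)
    qed
  qed
qed

text \<open>Orthogonality of the characters of the cyclic group, by the geometric sum. It yields
  both the decomposition of the unit in \<open>sum_e\<close> and the Fourier inversion in
  \<open>SQ_eq_sum_c\<close>.\<close>

lemma sum_powers_primitive_root:
  assumes w: "primitive_root_of_unity n (w::'a::field)"
  shows "(\<Sum>i<n. (w ^ j) ^ i) = (if n dvd j then of_nat n else 0)"
proof (cases "w ^ j = 1")
  case False
  have "(w ^ j) ^ n = 1"
    using w unfolding primitive_root_of_unity_def by (simp flip: power_mult)
  then show ?thesis
    using False w by (simp add: geometric_sum primitive_root_of_unity_def)
next
  case True
  then have "n dvd j" using w by (simp add: primitive_root_of_unity_def)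
  then show ?thesis unfolding True by simp
qed

section \<open>Linear algebra modulo a subspace\<close>

text \<open>Gaussian elimination, by induction on the set \<open>T\<close> of equations in the
  unknowns \<open>B\<close>: a pivot \<open>u\<close> for the equation \<open>t\<close> is
  eliminated from the others.\<close>

lemma homogeneous_system_nontrivial_solution:
  fixes M :: "'b \<Rightarrow> 't \<Rightarrow> 'a::field"
  assumes "finite T" "finite B" "card T < card B"
  shows "\<exists>c. (\<exists>b\<in>B. c b \<noteq> 0) \<and> (\<forall>t\<in>T. (\<Sum>b\<in>B. c b * M b t) = 0)"
  using assms
proof (induction T arbitrary: B M rule: finite_induct)
  case empty
  then have "B \<noteq> {}" by auto
  then show ?case by (intro exI[of _ "\<lambda>_. 1"]) auto
next
  case (insert t T)
  show ?case
  proof (cases "\<forall>b\<in>B. M b t = 0")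
    case True
    have "card T < card B" using insert by simp
    then obtain c where "\<exists>b\<in>B. c b \<noteq> 0" "\<forall>t\<in>T. (\<Sum>b\<in>B. c b * M b t) = 0"
      using insert.IH[OF \<open>finite B\<close>] by blast
    then show ?thesis using True by (intro exI[of _ c]) simp
  next
    case False
    then obtain u where u: "u \<in> B" "M u t \<noteq> 0" by blast
    define C where "C = B - {u}"
    have C: "finite C" "card T < card C" "u \<notin> C" "B = insert u C"
      using insert u by (auto simp: C_def)
    \<comment> \<open>The coefficients after elimination of \<open>u\<close>: \<open>N b t\<close>
      would be 0.\<close>
    define N where "N b s = M b s - M b t / M u t * M u s" for b s
    obtain c where c: "\<exists>b\<in>C. c b \<noteq> 0" "\<And>s. s \<in> T \<Longrightarrow> (\<Sum>b\<in>C. c b * N b s) = 0"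
      using insert.IH[OF C(1,2), of N] by blast
    \<comment> \<open>Equation \<open>t\<close> forces the value -\<open>d\<close> on the pivot
      unknown.\<close>
    define d where "d = (\<Sum>b\<in>C. c b * M b t) / M u t"
    define c' where "c' = c(u := - d)"
    have cC: "(\<Sum>b\<in>C. c' b * M b s) = (\<Sum>b\<in>C. c b * M b s)" for s
      using C(3) by (intro sum.cong) (auto simp: c'_def)
    have sumB: "(\<Sum>b\<in>B. c' b * M b s) = (\<Sum>b\<in>C. c b * M b s) - d * M u s" for s
      using C by (simp add: cC) (simp add: c'_def)
    have "(\<Sum>b\<in>B. c' b * M b s) = 0" if "s \<in> T" for s
    proof -
      have "0 = (\<Sum>b\<in>C. c b * N b s)" using c(2) that by simp
      also have "\<dots> = (\<Sum>b\<in>C. c b * M b s) - (\<Sum>b\<in>C. c b * M b t / M u t * M u s)"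
        by (simp add: N_def algebra_simps sum_subtractf)
      also have "(\<Sum>b\<in>C. c b * M b t / M u t * M u s) = d * M u s"
        by (simp add: d_def sum_distrib_right sum_divide_distrib)
      finally show ?thesis by (simp add: sumB)
    qed
    moreover have "(\<Sum>b\<in>B. c' b * M b t) = 0" using u by (simp add: sumB d_def)
    moreover have "\<exists>b\<in>B. c' b \<noteq> 0" using c(1) C by (auto simp: c'_def)
    ultimately show ?thesis by blast
  qed
qed

text \<open>A named scaling allows the vector space interpretation below, so that the general theory
  of spans replaces the explicit sums in \<open>lin_span\<close>.\<close>

definition smul :: "'a::field \<Rightarrow> 'a elt \<Rightarrow> 'a elt" where
  "smul a f = (\<lambda>k. a * f k)"

lemma smul_apply: "smul a f k = a * f k"
  by (simp add: smul_def)

interpretation elt: vector_space smul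
  by unfold_locales (auto simp: fun_eq_iff smul_apply algebra_simps)

lemma sum_elt_apply: "(\<Sum>x\<in>A. F x :: 'a::field elt) k = (\<Sum>x\<in>A. F x k)"
  by (induction A rule: infinite_finite_induct) auto

lemmas elt_apply = smul_apply sum_elt_apply plus_fun_apply zero_fun_apply

text \<open>
  The pointwise rules leave the simpset, because the simplifier would apply them to
  eta-expanded elements and turn sums into explicit functions of the key.
\<close>

declare plus_fun_apply [simp del] zero_fun_apply [simp del]

lemma lin_comb_eq_sum_smul: "(\<lambda>k. \<Sum>b\<in>B. c b * b k) = (\<Sum>b\<in>B. smul (c b) b)"
  by (simp add: fun_eq_iff elt_apply)

lemma lin_span_eq_span: "lin_span S = elt.span S"
  by (auto simp: lin_span_def elt.span_explicit lin_comb_eq_sum_smul)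

text \<open>The Steinitz bound modulo \<open>I\<close>: if \<open>B\<close> had more elements than
  \<open>T\<close>, the coefficients of its members over \<open>T\<close> would admit a nontrivial
  relation, which is a dependence of \<open>B\<close> modulo \<open>I\<close>.\<close>

lemma indep_mod_card_le:
  assumes I: "elt.subspace I" and T: "finite T" and B: "finite B" "indep_mod I B"
    and sub: "\<And>b. b \<in> B \<Longrightarrow> \<exists>v\<in>elt.span T. b - v \<in> I"
  shows "card B \<le> card T"
proof (rule ccontr)
  assume "\<not> card B \<le> card T"
  then have lt: "card T < card B" by simp
  have "\<exists>m. b - (\<Sum>t\<in>T. smul (m t) t) \<in> I" if b: "b \<in> B" for b
  proof -
    obtain v where "v \<in> elt.span T" "b - v \<in> I" using sub[OF b] by blast
    then show ?thesis unfolding elt.span_finite[OF T] by blast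
  qed
  then have "\<forall>b\<in>B. \<exists>m. b - (\<Sum>t\<in>T. smul (m t) t) \<in> I" by blast
  from bchoice[OF this] obtain M
    where M: "\<And>b. b \<in> B \<Longrightarrow> b - (\<Sum>t\<in>T. smul (M b t) t) \<in> I" by blast
  obtain c where c: "\<exists>b\<in>B. c b \<noteq> 0" "\<forall>t\<in>T. (\<Sum>b\<in>B. c b * M b t) = 0"
    using homogeneous_system_nontrivial_solution[OF T B(1) lt, of M] by blast
  have "(\<Sum>b\<in>B. smul (c b) (\<Sum>t\<in>T. smul (M b t) t))
      = (\<Sum>t\<in>T. smul (\<Sum>b\<in>B. c b * M b t) t)"
    by (simp add: elt.scale_sum_right elt.scale_sum_left sum.swap[of _ B T])
  also have "\<dots> = 0" using c(2) by simp
  finally have "(\<Sum>b\<in>B. smul (c b) b) = (\<Sum>b\<in>B. smul (c b) (b - (\<Sum>t\<in>T. smul (M b t) t)))"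
    by (simp add: elt.scale_right_diff_distrib sum_subtractf)
  also have "\<dots> \<in> I" by (intro elt.subspace_sum[OF I] elt.subspace_scale[OF I] M)
  finally show False using B(2) c(1) by (auto simp: indep_mod_def lin_comb_eq_sum_smul)
qed

lemma rank_mod_le:
  assumes I: "elt.subspace I" and T: "finite T"
    and sub: "\<And>v. v \<in> S \<Longrightarrow> \<exists>u\<in>elt.span T. v - u \<in> I"
  shows "rank_mod I S \<le> card T"
  unfolding rank_mod_def
proof (rule cSup_least)
  show "{card B |B. finite B \<and> B \<subseteq> S \<and> indep_mod I B} \<noteq> {}"
    by (auto intro!: exI[of _ "{}"] simp: indep_mod_def)
qed (auto intro!: indep_mod_card_le[OF I T] sub)

text \<open>The finite set \<open>T\<close> bounds the cardinalities; a supremum of naturals is an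
  upper bound only for a bounded set.\<close>

lemma card_le_rank_mod:
  assumes I: "elt.subspace I" and T: "finite T"
    and sub: "\<And>v. v \<in> S \<Longrightarrow> \<exists>u\<in>elt.span T. v - u \<in> I"
    and B: "finite B" "B \<subseteq> S" "indep_mod I B"
  shows "card B \<le> rank_mod I S"
  unfolding rank_mod_def
proof (rule cSup_upper)
  show "bdd_above {card B |B. finite B \<and> B \<subseteq> S \<and> indep_mod I B}"
    by (rule bdd_aboveI[of _ "card T"]) (auto intro!: indep_mod_card_le[OF I T] sub)
qed (use B in blast)

section \<open>The sign cocycle\<close>

lemma bij_betw_rotate: "n > 0 \<Longrightarrow> bij_betw (\<lambda>j. (j + g) mod n) {..<n} {..<n::nat}"
proof -
  assume n: "n > 0"
  have "inj_on (\<lambda>j. (j + g) mod n) {..<n}"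
  proof (rule inj_onI)
    fix i j assume ij: "i \<in> {..<n}" "j \<in> {..<n}" and eq: "(i + g) mod n = (j + g) mod n"
    have "[i + g = j + g] (mod n)" unfolding Cong.cong_def by (rule eq)
    then have "[i = j] (mod n)" by (simp only: cong_add_rcancel_nat)
    then show "i = j" using ij by (simp add: Cong.cong_def)
  qed
  moreover have "(\<lambda>j. (j + g) mod n) ` {..<n} \<subseteq> {..<n}" using n by auto
  ultimately show ?thesis
    by (simp add: bij_betw_def endo_inj_surj)
qed

lemma rotate_surjE:
  assumes "n > 0" "i < (n::nat)"
  obtains j where "j < n" "i = (j + g) mod n"
proof -
  have "i \<in> (\<lambda>j. (j + g) mod n) ` {..<n}"
    using bij_betw_imp_surj_on[OF bij_betw_rotate[OF assms(1), of g]] assms(2) by simp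
  then show thesis by (rule imageE) (auto intro: that)
qed

text \<open>Describes \<open>shift\<close> along the rotation itself, which spares later reindexings
  the subtraction in its definition.\<close>

lemma shift_rotate: "j < n \<Longrightarrow> shift n g b ((j + g) mod n) = b j"
proof -
  assume j: "j < n"
  have "((j + g) mod n + n - g mod n) mod n = j"
  proof -
    have "g mod n \<le> n" using j by (simp add: less_imp_le)
    then have "((j + g) mod n + n - g mod n) mod n = ((j + g) mod n + (n - g mod n)) mod n" by simp
    also have "\<dots> = (j + g mod n + (n - g mod n)) mod n"
      by (metis mod_add_left_eq mod_add_right_eq)
    also have "\<dots> = j" using j \<open>g mod n \<le> n\<close> by simp
    finally show ?thesis .
  qed
  then show ?thesis using j by (simp add: shift_def)
qed

lemma shift_eqI:
  assumes "n > 0" "\<And>i. i \<ge> n \<Longrightarrow> a i = 0" "\<And>j. j < n \<Longrightarrow> a ((j + g) mod n) = b j"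
  shows "shift n g b = a"
proof
  fix i
  show "shift n g b i = a i"
  proof (cases "i < n")
    case True
    then obtain j where "j < n" "i = (j + g) mod n"
      by (rule rotate_surjE[OF assms(1)])
    then show ?thesis using assms(3) by (simp add: shift_rotate)
  qed (simp add: assms shift_def)
qed

lemma shift_add: "shift n g (\<lambda>i. a i + b i) = (\<lambda>i. shift n g a i + shift n g b i)"
  by (auto simp: shift_def)

lemma shift_shift: "n > 0 \<Longrightarrow> shift n g (shift n h b) = shift n (g + h) b"
proof (rule shift_eqI)
  fix j assume "n > 0" "j < n"
  show "shift n (g + h) b ((j + g) mod n) = shift n h b j"
  proof -
    obtain i where i: "i < n" "j = (i + h) mod n"
      by (rule rotate_surjE[OF \<open>n > 0\<close> \<open>j < n\<close>])
    have "(j + g) mod n = (i + (g + h)) mod n" by (simp add: i mod_simps ac_simps)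
    then show ?thesis by (metis i shift_rotate)
  qed
qed (auto simp: shift_def)

lemma shift_mod: "shift n (g mod n) b = shift n g b"
  by (simp add: shift_def fun_eq_iff mod_mod_trivial)

lemma key_mult_assoc:
  "n > 0 \<Longrightarrow> key_mult n (key_mult n x y) z = key_mult n x (key_mult n y z)"
  by (simp add: key_mult_def shift_add shift_shift shift_mod mod_simps ac_simps)

lemma sum_pairs_reindex:
  assumes \<pi>: "bij_betw \<pi> A A"
  shows "(\<Sum>i\<in>A. \<Sum>j\<in>A. F i j) = (\<Sum>i\<in>A. \<Sum>j\<in>A. F (\<pi> i) (\<pi> j))"
proof -
  have "(\<Sum>i\<in>A. \<Sum>j\<in>A. F i j) = (\<Sum>i\<in>A. \<Sum>j\<in>A. F (\<pi> i) j)"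
    by (rule sum.reindex_bij_betw[OF \<pi>, symmetric])
  also have "\<dots> = (\<Sum>i\<in>A. \<Sum>j\<in>A. F (\<pi> i) (\<pi> j))"
    by (intro sum.cong refl sum.reindex_bij_betw[OF \<pi>, symmetric])
  finally show ?thesis .
qed

text \<open>Twice the sum over i < j of a symmetric \<open>F\<close> is the sum over i \<noteq> j,
  and the latter is visibly invariant under permutations.\<close>

lemma sum_ordered_pairs_reindex:
  fixes F :: "nat \<Rightarrow> nat \<Rightarrow> nat"
  assumes \<pi>: "bij_betw \<pi> {..<n} {..<n}" and sym: "\<And>i j. F i j = F j i"
  shows "(\<Sum>i<n. \<Sum>j<n. if i < j then F (\<pi> i) (\<pi> j) else 0) = (\<Sum>i<n. \<Sum>j<n. if i < j then F i j else 0)"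
proof -
  have twice: "2 * (\<Sum>i<n. \<Sum>j<n. if i < j then G i j else 0) = (\<Sum>i<n. \<Sum>j<n. if i \<noteq> j then G i j else 0)"
    if "\<And>i j. G i j = G j i" for G :: "nat \<Rightarrow> nat \<Rightarrow> nat"
  proof -
    have "(\<Sum>i<n. \<Sum>j<n. if i < j then G i j else 0) = (\<Sum>i<n. \<Sum>j<n. if j < i then G j i else 0)"
      by (rule sum.swap)
    then have "2 * (\<Sum>i<n. \<Sum>j<n. if i < j then G i j else 0)
        = (\<Sum>i<n. \<Sum>j<n. (if i < j then G i j else 0) + (if j < i then G j i else 0))"
      by (simp add: sum.distrib)
    also have "\<dots> = (\<Sum>i<n. \<Sum>j<n. if i \<noteq> j then G i j else 0)"
      using that by (intro sum.cong) auto
    finally show ?thesis .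
  qed
  have "2 * (\<Sum>i<n. \<Sum>j<n. if i < j then F i j else 0) = (\<Sum>i<n. \<Sum>j<n. if i \<noteq> j then F i j else 0)"
    by (rule twice[OF sym])
  also have "\<dots> = (\<Sum>i<n. \<Sum>j<n. if \<pi> i \<noteq> \<pi> j then F (\<pi> i) (\<pi> j) else 0)"
    by (rule sum_pairs_reindex[OF \<pi>])
  also have "\<dots> = (\<Sum>i<n. \<Sum>j<n. if i \<noteq> j then F (\<pi> i) (\<pi> j) else 0)"
    using \<pi> by (intro sum.cong) (auto simp: bij_betw_def dest: inj_onD)
  also have "\<dots> = 2 * (\<Sum>i<n. \<Sum>j<n. if i < j then F (\<pi> i) (\<pi> j) else 0)"
    by (rule twice[symmetric]) (rule sym)
  finally show ?thesis by simp
qed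

lemma neg_one_power_eqI: "a + 2 * c = b \<Longrightarrow> (-1::int) ^ a = (-1) ^ b"
  by (auto simp: power_add power_mult)

text \<open>
  A pair is inverted by a composite rotation iff exactly one of the two rotations inverts it.
\<close>

lemma act_sign_add:
  assumes n: "n > 0"
  shows "act_sign n (g + h) c = act_sign n h c * act_sign n g (shift n h c)"
proof -
  define \<pi> where "\<pi> = (\<lambda>j. (j + h) mod n)"
  define \<rho> where "\<rho> = (\<lambda>j. (j + g) mod n)"
  have \<pi>: "bij_betw \<pi> {..<n} {..<n}" unfolding \<pi>_def by (rule bij_betw_rotate[OF n])
  have \<rho>\<pi>: "(j + (g + h)) mod n = \<rho> (\<pi> j)" for j by (simp add: \<rho>_def \<pi>_def mod_simps ac_simps)
  \<comment> \<open>Symmetrised in \<open>u\<close> and \<open>v\<close>, so that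
    \<open>sum_ordered_pairs_reindex\<close> applies.\<close>
  define inv where "inv u v \<longleftrightarrow> (u < v \<and> \<rho> u > \<rho> v) \<or> (v < u \<and> \<rho> v > \<rho> u)" for u v
  have 1: "(\<Sum>u<n. \<Sum>v<n. if u < v \<and> \<rho> u > \<rho> v then shift n h c u * shift n h c v else 0)
     = (\<Sum>i<n. \<Sum>j<n. if i < j then (if inv (\<pi> i) (\<pi> j) then c i * c j else 0) else 0)"
  proof -
    define F where "F u v = (if inv u v then shift n h c u * shift n h c v else 0)" for u v
    have "(\<Sum>u<n. \<Sum>v<n. if u < v \<and> \<rho> u > \<rho> v then shift n h c u * shift n h c v else 0)
        = (\<Sum>u<n. \<Sum>v<n. if u < v then F u v else 0)"
      by (intro sum.cong) (auto simp: F_def inv_def)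
    also have "\<dots> = (\<Sum>u<n. \<Sum>v<n. if u < v then F (\<pi> u) (\<pi> v) else 0)"
      by (rule sum_ordered_pairs_reindex[OF \<pi>, symmetric]) (auto simp: F_def inv_def mult.commute)
    also have "\<dots> = (\<Sum>i<n. \<Sum>j<n. if i < j then (if inv (\<pi> i) (\<pi> j) then c i * c j else 0) else 0)"
      by (intro sum.cong) (auto simp: F_def \<pi>_def shift_rotate)
    finally show ?thesis .
  qed
  \<comment> \<open>The contribution of the pairs inverted by both rotations; it occurs twice and so
    vanishes modulo 2.\<close>
  define X where "X = (\<Sum>i<n. \<Sum>j<n. if i < j \<and> \<pi> i > \<pi> j \<and> inv (\<pi> i) (\<pi> j) then c i * c j else 0)"
  have "(\<Sum>i<n. \<Sum>j<n. if i < j \<and> \<rho> (\<pi> i) > \<rho> (\<pi> j) then c i * c j else 0) + 2 * X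
     = (\<Sum>i<n. \<Sum>j<n. if i < j \<and> \<pi> i > \<pi> j then c i * c j else 0)
     + (\<Sum>i<n. \<Sum>j<n. if i < j then (if inv (\<pi> i) (\<pi> j) then c i * c j else 0) else 0)"
    unfolding X_def sum_distrib_left sum.distrib[symmetric]
  proof (intro sum.cong refl)
    fix i j assume "i \<in> {..<n}" "j \<in> {..<n}"
    then have "i \<noteq> j \<Longrightarrow> \<pi> i \<noteq> \<pi> j" "\<pi> i \<noteq> \<pi> j \<Longrightarrow> \<rho> (\<pi> i) \<noteq> \<rho> (\<pi> j)"
      using \<pi> bij_betw_rotate[OF n, of g] unfolding bij_betw_def \<rho>_def
      by (auto dest!: inj_onD)
    then show "(if i < j \<and> \<rho> (\<pi> j) < \<rho> (\<pi> i) then c i * c j else 0) +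
           2 * (if i < j \<and> \<pi> j < \<pi> i \<and> inv (\<pi> i) (\<pi> j) then c i * c j else 0) =
           (if i < j \<and> \<pi> j < \<pi> i then c i * c j else 0) +
           (if i < j then if inv (\<pi> i) (\<pi> j) then c i * c j else 0 else 0)"
      unfolding inv_def by (cases "i < j") (auto simp: not_less order_le_less)
  qed
  then show ?thesis
    unfolding act_sign_def \<rho>\<pi> power_add[symmetric] 1[symmetric] \<pi>_def[symmetric, THEN fun_cong]
      \<rho>_def[symmetric, THEN fun_cong]
    by (rule neg_one_power_eqI)
qed

text \<open>
  The action is multiplicative: applied to \<open>x\<^sup>b x\<^sup>d = \<plusminus> x\<^sup>b\<^sup>+\<^sup>d\<close>, both ways of reordering agree.
\<close>

lemma act_sign_mult:
  assumes n: "n > 0"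
  shows "act_sign n g b * act_sign n g d * mon_sign n (shift n g b) (shift n g d)
    = mon_sign n b d * act_sign n g (\<lambda>i. b i + d i)"
proof -
  define \<pi> where "\<pi> = (\<lambda>j. (j + g) mod n)"
  have \<pi>: "bij_betw \<pi> {..<n} {..<n}" unfolding \<pi>_def by (rule bij_betw_rotate[OF n])
  have q: "(\<Sum>u<n. \<Sum>v<n. if v < u then shift n g b u * shift n g d v else 0)
     = (\<Sum>i<n. \<Sum>j<n. if \<pi> j < \<pi> i then b i * d j else 0)"
  proof -
    have "(\<Sum>u<n. \<Sum>v<n. if v < u then shift n g b u * shift n g d v else 0)
       = (\<Sum>i<n. \<Sum>j<n. if \<pi> j < \<pi> i then shift n g b (\<pi> i) * shift n g d (\<pi> j) else 0)"
      by (rule sum_pairs_reindex[OF \<pi>])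
    also have "\<dots> = (\<Sum>i<n. \<Sum>j<n. if \<pi> j < \<pi> i then b i * d j else 0)"
      by (intro sum.cong) (auto simp: \<pi>_def shift_rotate)
    finally show ?thesis .
  qed
  \<comment> \<open>A bilinear form whose diagonal value at b is the exponent of
    \<open>act_sign n g b\<close>; the mixed terms measure the failure of that sign to be
    multiplicative.\<close>
  define A where "A f f' = (\<Sum>i<n. \<Sum>j<n. if i < j \<and> \<pi> i > \<pi> j then f i * f' j else 0)" for f f' :: "nat \<Rightarrow> nat"
  define D where "D = (\<Sum>i<n. \<Sum>j<n. if j < i \<and> \<pi> j < \<pi> i then b i * d j else 0)"
  have swap: "A d b = (\<Sum>i<n. \<Sum>j<n. if j < i \<and> \<pi> j > \<pi> i then b i * d j else 0)"
    unfolding A_def by (subst sum.swap) (intro sum.cong refl, simp add: mult.commute)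
  \<comment> \<open>Modulo 2 the mixed terms are the exponents of the two monomial signs, after and
    before the rotation. \<open>D\<close> collects the pairs out of order both times.\<close>
  have cross: "A b d + A d b + 2 * D = (\<Sum>i<n. \<Sum>j<n. if \<pi> j < \<pi> i then b i * d j else 0)
     + (\<Sum>i<n. \<Sum>j<n. if j < i then b i * d j else 0)"
    unfolding swap unfolding A_def D_def sum_distrib_left sum.distrib[symmetric]
  proof (intro sum.cong refl)
    fix i j assume "i \<in> {..<n}" "j \<in> {..<n}"
    then have "i \<noteq> j \<Longrightarrow> \<pi> i \<noteq> \<pi> j" using \<pi> unfolding bij_betw_def by (auto dest: inj_onD)
    then show "(if i < j \<and> \<pi> j < \<pi> i then b i * d j else 0) + (if j < i \<and> \<pi> i < \<pi> j then b i * d j else 0) +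
       2 * (if j < i \<and> \<pi> j < \<pi> i then b i * d j else 0) =
       (if \<pi> j < \<pi> i then b i * d j else 0) + (if j < i then b i * d j else 0)"
      by (cases "i < j"; cases "j < i") auto
  qed
  have expand: "A (\<lambda>i. b i + d i) (\<lambda>i. b i + d i) = A b b + A d d + A b d + A d b"
    unfolding A_def sum.distrib[symmetric]
    by (intro sum.cong) (auto simp: algebra_simps)
  define q1 where "q1 = (\<Sum>i<n. \<Sum>j<n. if \<pi> j < \<pi> i then b i * d j else 0)"
  define q2 where "q2 = (\<Sum>i<n. \<Sum>j<n. if j < i then b i * d j else 0)"
  have "A b b + A d d + q1 + 2 * q2 = q2 + A (\<lambda>i. b i + d i) (\<lambda>i. b i + d i) + 2 * D"
    using cross expand unfolding q1_def[symmetric] q2_def[symmetric] by linarith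
  then have "(-1::int) ^ (A b b + A d d + q1) = (-1) ^ (q2 + A (\<lambda>i. b i + d i) (\<lambda>i. b i + d i))"
    by (metis neg_one_power_eqI)
  then show ?thesis
    unfolding act_sign_def mon_sign_def q
    unfolding power_add[symmetric] A_def \<pi>_def q1_def q2_def .
qed

lemma mon_sign_add_left: "mon_sign n (\<lambda>i. a i + b i) c = mon_sign n a c * mon_sign n b c"
  unfolding mon_sign_def power_add[symmetric] sum.distrib[symmetric]
  by (intro arg_cong[where f="(^) (-1)"] sum.cong) (auto simp: algebra_simps)

lemma mon_sign_add_right: "mon_sign n c (\<lambda>i. a i + b i) = mon_sign n c a * mon_sign n c b"
  unfolding mon_sign_def power_add[symmetric] sum.distrib[symmetric]
  by (intro arg_cong[where f="(^) (-1)"] sum.cong) (auto simp: algebra_simps)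

lemma act_sign_mod: "act_sign n (g mod n) b = act_sign n g b"
  by (simp add: act_sign_def mod_simps)

text \<open>This is associativity on basis elements. Once the signs are expanded by
  bimultiplicativity of \<open>mon_sign\<close> and \<open>act_sign_add\<close>, the two sides
  differ exactly by \<open>act_sign_mult\<close>.\<close>

lemma key_sign_cocycle:
  assumes n: "n > 0"
  shows "key_sign n x y * key_sign n (key_mult n x y) z = key_sign n y z * key_sign n x (key_mult n y z)"
proof -
  obtain a g b h c l where [simp]: "x = (a, g)" "y = (b, h)" "z = (c, l)" by (metis surj_pair)
  define d where "d = shift n h c"
  have "key_sign n x y * key_sign n (key_mult n x y) z
     = act_sign n h c * (act_sign n g b * act_sign n g d * mon_sign n (shift n g b) (shift n g d))
       * mon_sign n a (shift n g b) * mon_sign n a (shift n g d)"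
    using n by (simp add: key_sign_def key_mult_def act_sign_mod shift_mod mon_sign_add_left
        act_sign_add shift_shift[symmetric] d_def[symmetric])
  also have "act_sign n g b * act_sign n g d * mon_sign n (shift n g b) (shift n g d)
    = mon_sign n b d * act_sign n g (\<lambda>i. b i + d i)" by (rule act_sign_mult[OF n])
  also have "act_sign n h c * (mon_sign n b d * act_sign n g (\<lambda>i. b i + d i))
       * mon_sign n a (shift n g b) * mon_sign n a (shift n g d)
     = key_sign n y z * key_sign n x (key_mult n y z)"
    using n by (simp add: key_sign_def key_mult_def shift_add mon_sign_add_right d_def[symmetric])
  finally show ?thesis .
qed

section \<open>The skew group algebra\<close>

lemma supp_zero [simp]: "supp 0 = {}"
  by (simp add: supp_def elt_apply)

lemma supp_basis_el [simp]: "supp (basis_el k :: 'a::field elt) = {k}"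
  by (auto simp: supp_def basis_el_def)

lemma supp_add: "supp (f + g) \<subseteq> supp f \<union> supp (g :: 'a::field elt)"
  by (auto simp: supp_def elt_apply)

lemma supp_smul: "supp (smul a f) \<subseteq> supp f"
  by (auto simp: supp_def elt_apply)

lemma finite_supp_add [simp]:
  "finite (supp f) \<Longrightarrow> finite (supp g) \<Longrightarrow> finite (supp (f + g :: 'a::field elt))"
  by (rule finite_subset[OF supp_add]) simp

lemma finite_supp_smul [simp]: "finite (supp f) \<Longrightarrow> finite (supp (smul a f))"
  by (rule finite_subset[OF supp_smul])

text \<open>Index sets larger than the supports are allowed so that products of elements with
  different supports can be added termwise.\<close>

lemma sk_mult_expand:
  assumes "finite F" "finite H" "supp f \<subseteq> F" "supp h \<subseteq> H"
  shows "sk_mult n f h = (\<Sum>x\<in>F. \<Sum>y\<in>H.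
    smul (of_int (key_sign n x y) * f x * h y) (basis_el (key_mult n x y)))"
proof
  fix k
  have "sk_mult n f h k = (\<Sum>p\<in>F \<times> H. if key_mult n (fst p) (snd p) = k
      then of_int (key_sign n (fst p) (snd p)) * f (fst p) * h (snd p) else 0)"
    unfolding sk_mult_def using assms
    by (intro sum.mono_neutral_left) (auto simp: supp_def)
  also have "\<dots> = (\<Sum>x\<in>F. \<Sum>y\<in>H.
    smul (of_int (key_sign n x y) * f x * h y) (basis_el (key_mult n x y))) k"
    by (simp add: sum.cartesian_product basis_el_def case_prod_beta elt_apply if_distrib eq_commute cong: if_cong)
  finally show "sk_mult n f h k = (\<Sum>x\<in>F. \<Sum>y\<in>H.
    smul (of_int (key_sign n x y) * f x * h y) (basis_el (key_mult n x y))) k" .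
qed

lemma sk_mult_basis_el:
  "sk_mult n (basis_el x) (basis_el y) = smul (of_int (key_sign n x y)) (basis_el (key_mult n x y))"
  by (simp add: sk_mult_expand[of "{x}" "{y}"]) (simp add: basis_el_def)

lemma sk_mult_add_left:
  assumes "finite (supp f)" "finite (supp g)" "finite (supp h)"
  shows "sk_mult n (f + g) h = sk_mult n f h + sk_mult n g h"
proof -
  let ?F = "supp f \<union> supp g"
  have "sk_mult n u h = (\<Sum>x\<in>?F. \<Sum>y\<in>supp h.
      smul (of_int (key_sign n x y) * u x * h y) (basis_el (key_mult n x y)))"
    if "supp u \<subseteq> ?F" for u
    using assms that by (intro sk_mult_expand) auto
  then show ?thesis
    by (simp add: supp_add elt_apply distrib_left distrib_right elt.scale_left_distrib sum.distrib)
qed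

lemma sk_mult_add_right:
  assumes "finite (supp f)" "finite (supp g)" "finite (supp h)"
  shows "sk_mult n h (f + g) = sk_mult n h f + sk_mult n h g"
proof -
  let ?F = "supp f \<union> supp g"
  have "sk_mult n h u = (\<Sum>x\<in>supp h. \<Sum>y\<in>?F.
      smul (of_int (key_sign n x y) * h x * u y) (basis_el (key_mult n x y)))"
    if "supp u \<subseteq> ?F" for u
    using assms that by (intro sk_mult_expand) auto
  then show ?thesis
    by (simp add: supp_add elt_apply distrib_left distrib_right elt.scale_left_distrib sum.distrib)
qed

lemma sk_mult_smul_left [simp]:
  assumes "finite (supp f)" "finite (supp h)"
  shows "sk_mult n (smul a f) h = smul a (sk_mult n f h)"
proof -
  have "sk_mult n u h = (\<Sum>x\<in>supp f. \<Sum>y\<in>supp h.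
      smul (of_int (key_sign n x y) * u x * h y) (basis_el (key_mult n x y)))"
    if "supp u \<subseteq> supp f" for u
    using assms that by (intro sk_mult_expand) auto
  then show ?thesis
    by (simp add: supp_smul elt.scale_sum_right elt_apply mult_ac)
qed

lemma sk_mult_smul_right [simp]:
  assumes "finite (supp f)" "finite (supp h)"
  shows "sk_mult n h (smul a f) = smul a (sk_mult n h f)"
proof -
  have "sk_mult n h u = (\<Sum>x\<in>supp h. \<Sum>y\<in>supp f.
      smul (of_int (key_sign n x y) * h x * u y) (basis_el (key_mult n x y)))"
    if "supp u \<subseteq> supp f" for u
    using assms that by (intro sk_mult_expand) auto
  then show ?thesis
    by (simp add: supp_smul elt.scale_sum_right elt_apply mult_ac)
qed

lemma sk_mult_zero [simp]: "sk_mult n 0 h = 0" "sk_mult n h 0 = 0"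
  by (simp_all add: sk_mult_def fun_eq_iff elt_apply)

lemma supp_sk_mult:
  "supp (sk_mult n f h) \<subseteq> (\<lambda>p. key_mult n (fst p) (snd p)) ` (supp f \<times> supp h)"
proof
  fix k assume "k \<in> supp (sk_mult n f h)"
  then have "sk_mult n f h k \<noteq> 0" by (simp add: supp_def)
  then show "k \<in> (\<lambda>p. key_mult n (fst p) (snd p)) ` (supp f \<times> supp h)"
    unfolding sk_mult_def
    by (rule sum.not_neutral_contains_not_neutral) (auto split: if_splits)
qed

lemma finite_supp_sk_mult [simp]:
  "finite (supp f) \<Longrightarrow> finite (supp h) \<Longrightarrow> finite (supp (sk_mult n f h))"
  by (rule finite_subset[OF supp_sk_mult]) simp

lemma finite_supp_induct [consumes 1, case_names zero add]:
  fixes f :: "'a::field elt"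
  assumes "finite (supp f)" "P 0"
    and step: "\<And>a k f. finite (supp f) \<Longrightarrow> P f \<Longrightarrow> P (smul a (basis_el k) + f)"
  shows "P f"
proof -
  have "P f" if "finite S" "supp f \<subseteq> S" for S and f :: "'a elt"
    using that
  proof (induction S arbitrary: f rule: finite_induct)
    case empty
    then have "f = 0" by (auto simp: supp_def elt_apply)
    then show ?case using assms(2) by simp
  next
    case (insert k S)
    have sub: "supp (f(k := 0)) \<subseteq> S" using insert.prems by (auto simp: supp_def)
    have "f = smul (f k) (basis_el k) + f(k := 0)"
      by (auto simp: fun_eq_iff basis_el_def elt_apply)
    moreover have "finite (supp (f(k := 0)))" using sub insert.hyps(1) by (rule finite_subset)
    ultimately show ?case using step[OF _ insert.IH[OF sub]] by metis
  qed
  then show ?thesis using assms(1) by blast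
qed

text \<open>Three nested inductions over supports reduce the claim, linear in each factor, to basis
  elements, where it is \<open>key_sign_cocycle\<close>.\<close>

lemma sk_mult_assoc:
  fixes f g h :: "'a::field elt"
  assumes n: "n > 0" and "finite (supp f)" "finite (supp g)" "finite (supp h)"
  shows "sk_mult n (sk_mult n f g) h = sk_mult n f (sk_mult n g h)"
  using assms(2)
proof (induction f rule: finite_supp_induct)
  case (add a x f)
  have "sk_mult n (sk_mult n (basis_el x :: 'a elt) g) h = sk_mult n (basis_el x) (sk_mult n g h)"
    using assms(3)
  proof (induction g rule: finite_supp_induct)
    case (add a y g)
    have "sk_mult n (sk_mult n (basis_el x :: 'a elt) (basis_el y)) h
        = sk_mult n (basis_el x) (sk_mult n (basis_el y) h)"
      using assms(4)
    proof (induction h rule: finite_supp_induct)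
      case (add a z h)
      have "sk_mult n (sk_mult n (basis_el x :: 'a elt) (basis_el y)) (basis_el z)
          = sk_mult n (basis_el x) (sk_mult n (basis_el y) (basis_el z))"
        using key_sign_cocycle[OF n, of x y z]
        by (simp add: sk_mult_basis_el key_mult_assoc[OF n] flip: of_int_mult)
      then show ?case using add by (simp add: sk_mult_add_right)
    qed simp
    then show ?case using add assms(4) by (simp add: sk_mult_add_right sk_mult_add_left)
  qed simp
  then show ?case using add assms(3,4) by (simp add: sk_mult_add_left)
qed simp

lemma subspace_carrier_sk: "elt.subspace (carrier_sk n :: 'a::field elt set)"
  unfolding elt.subspace_def carrier_sk_def
  using supp_add[where ?'a='a] supp_smul[where ?'a='a] by fastforce

lemma carrier_sk_finite_supp: "f \<in> carrier_sk n \<Longrightarrow> finite (supp f)"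
  by (simp add: carrier_sk_def)

lemma valid_key_mult: "n > 0 \<Longrightarrow> valid_key n x \<Longrightarrow> valid_key n y \<Longrightarrow> valid_key n (key_mult n x y)"
  by (auto simp: valid_key_def key_mult_def shift_def)

lemma carrier_sk_sk_mult:
  "n > 0 \<Longrightarrow> f \<in> carrier_sk n \<Longrightarrow> h \<in> carrier_sk n \<Longrightarrow> sk_mult n f h \<in> carrier_sk n"
  using supp_sk_mult[of n f h] unfolding carrier_sk_def
  by (auto dest!: subsetD intro!: valid_key_mult)

lemma carrier_sk_basis_el: "(basis_el k :: 'a::field elt) \<in> carrier_sk n \<longleftrightarrow> valid_key n k"
  by (simp add: carrier_sk_def)

section \<open>Signs and shifts for the unit, the variables and their squares\<close>

lemma act_sign_zero_vec [simp]: "act_sign n g (\<lambda>_. 0) = 1"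
  by (simp add: act_sign_def cong: if_cong)

lemma act_sign_0: "act_sign n 0 b = 1"
proof -
  have "(\<Sum>j<n. \<Sum>j'<n. if j < j' \<and> (j + 0) mod n > (j' + 0) mod n then b j * b j' else 0) = 0"
    by (intro sum.neutral) auto
  then show ?thesis by (simp add: act_sign_def)
qed

text \<open>Even exponents contribute only even sign exponents. With the two
  \<open>mon_sign_double\<close> lemmas this makes the squares of the variables commute with all of
  \<open>A\<close>.\<close>

lemma act_sign_double [simp]: "act_sign n g (\<lambda>i. 2 * b i) = 1"
proof -
  have "even (\<Sum>j<n. \<Sum>j'<n. if j < j' \<and> (j + g) mod n > (j' + g) mod n then 2 * b j * (2 * b j') else 0)"
    by (intro dvd_sum) auto
  then show ?thesis by (simp add: act_sign_def)
qed

lemma act_sign_var_exp [simp]: "act_sign n g (var_exp i) = 1"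
proof -
  have "(\<Sum>j<n. \<Sum>j'<n. if j < j' \<and> (j + g) mod n > (j' + g) mod n then var_exp i j * var_exp i j' else 0) = 0"
    by (intro sum.neutral ballI) (auto simp: var_exp_def)
  then show ?thesis by (simp add: act_sign_def)
qed

lemma mon_sign_zero_vec [simp]: "mon_sign n a (\<lambda>_. 0) = 1" "mon_sign n (\<lambda>_. 0) a = 1"
  by (simp_all add: mon_sign_def cong: if_cong)

lemma mon_sign_double_left [simp]: "mon_sign n (\<lambda>i. 2 * a i) c = 1"
proof -
  have "even (\<Sum>i<n. \<Sum>j<n. if j < i then 2 * a i * c j else 0)"
    by (intro dvd_sum) auto
  then show ?thesis by (simp add: mon_sign_def)
qed

lemma mon_sign_double_right [simp]: "mon_sign n c (\<lambda>i. 2 * a i) = 1"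
proof -
  have "even (\<Sum>i<n. \<Sum>j<n. if j < i then c i * (2 * a j) else 0)"
    by (intro dvd_sum) auto
  then show ?thesis by (simp add: mon_sign_def)
qed

lemma mon_sign_var_exp:
  assumes "u < n" "v < n"
  shows "mon_sign n (var_exp u) (var_exp v) = (if v < u then -1 else 1)"
proof -
  have "(\<Sum>i<n. \<Sum>j<n. if j < i then var_exp u i * var_exp v j else 0)
      = (\<Sum>i<n. \<Sum>j<n. if j = v then (if i = u then (if v < u then 1 else 0) else 0) else 0)"
    by (intro sum.cong refl) (auto simp: var_exp_def)
  also have "\<dots> = (if v < u then 1 else 0)" using assms by simp
  finally show ?thesis by (simp add: mon_sign_def)
qed

lemma shift_0: "\<forall>i\<ge>n. b i = 0 \<Longrightarrow> shift n 0 b = b"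
  by (auto simp: shift_def fun_eq_iff)

lemma shift_zero_vec [simp]: "shift n g (\<lambda>_. 0) = (\<lambda>_. 0)"
  by (auto simp: shift_def)

lemma shift_double: "shift n g (\<lambda>i. 2 * b i) = (\<lambda>i. 2 * shift n g b i)"
  by (auto simp: shift_def)

lemma shift_var_exp:
  assumes "i < n"
  shows "shift n g (var_exp i) = var_exp ((i + g) mod n)"
proof (rule shift_eqI)
  show "n > 0" using assms by simp
next
  fix j assume "j < n"
  have "(j + g) mod n = (i + g) mod n \<longleftrightarrow> j = i"
    using bij_betw_rotate[of n g] \<open>j < n\<close> assms
    by (metis (no_types, lifting) bij_betw_def inj_onD lessThan_iff not_less_zero zero_less_iff_neq_zero)
  then show "var_exp ((i + g) mod n) ((j + g) mod n) = var_exp i j"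
    by (simp add: var_exp_def)
next
  fix j assume "j \<ge> n"
  moreover have "(i + g) mod n < n" using assms by simp
  ultimately show "var_exp ((i + g) mod n) j = 0" by (auto simp: var_exp_def)
qed

lemma valid_key_basic:
  "i < n \<Longrightarrow> valid_key n (var_exp i, 0)" "i < n \<Longrightarrow> valid_key n (\<lambda>j. 2 * var_exp i j, 0)"
  "g < n \<Longrightarrow> valid_key n (\<lambda>_. 0, g)"
  by (auto simp: valid_key_def var_exp_def)

lemma sk_one_left:
  assumes "f \<in> carrier_sk n" shows "sk_mult n sk_one f = f"
proof -
  have "sk_mult n sk_one f = (\<Sum>y\<in>supp f. smul (f y) (basis_el y))"
    using assms
    by (subst sk_mult_expand[of "{((\<lambda>_. 0), 0)}" "supp f"])
      (auto simp: carrier_sk_def sk_one_def supp_basis_el[unfolded basis_el_def] basis_el_def key_sign_def key_mult_def act_sign_0 shift_0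
        valid_key_def subset_iff fun_eq_iff elt_apply intro!: sum.cong)
  also have "\<dots> = f" 
    using assms by (auto simp: fun_eq_iff elt_apply basis_el_def supp_def carrier_sk_def sum.If_cases if_distrib cong: if_cong)
  finally show ?thesis .
qed

lemma sk_one_right:
  assumes "f \<in> carrier_sk n" shows "sk_mult n f sk_one = f"
proof -
  have "sk_mult n f sk_one = (\<Sum>y\<in>supp f. smul (f y) (basis_el y))"
    using assms
    by (subst sk_mult_expand[of "supp f" "{((\<lambda>_. 0), 0)}"])
      (auto simp: carrier_sk_def sk_one_def supp_basis_el[unfolded basis_el_def] basis_el_def key_sign_def key_mult_def act_sign_0 shift_0
        valid_key_def subset_iff fun_eq_iff elt_apply intro!: sum.cong)
  also have "\<dots> = f" 
    using assms by (auto simp: fun_eq_iff elt_apply basis_el_def supp_def carrier_sk_def sum.If_cases if_distrib cong: if_cong)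
  finally show ?thesis .
qed

section \<open>Fourier transform of the generators\<close>

text \<open>Algebraic closedness enters only through the existence of \<open>w\<close>.\<close>

locale skew_fourier =
  fixes n :: nat and w :: "'a::field_char_0"
  assumes n_pos: "n > 0" and prim: "primitive_root_of_unity n w"
begin

abbreviation mul :: "'a elt \<Rightarrow> 'a elt \<Rightarrow> 'a elt" (infixl \<open>\<odot>\<close> 70) where "mul \<equiv> sk_mult n"
abbreviation Car :: "'a elt set" where "Car \<equiv> carrier_sk n"
abbreviation I :: "'a elt set" where "I \<equiv> ideal_e0 n"

lemma Car_closed [simp]:
  "0 \<in> Car" "f \<in> Car \<Longrightarrow> g \<in> Car \<Longrightarrow> f + g \<in> Car" "f \<in> Car \<Longrightarrow> smul a f \<in> Car"
  "f \<in> Car \<Longrightarrow> g \<in> Car \<Longrightarrow> f \<odot> g \<in> Car"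
  using subspace_carrier_sk[of n, where 'a='a] carrier_sk_sk_mult[OF n_pos]
  by (auto simp: elt.subspace_def)

lemma Car_sum [simp]: "(\<And>i. i \<in> A \<Longrightarrow> F i \<in> Car) \<Longrightarrow> sum F A \<in> Car"
  by (rule elt.subspace_sum[OF subspace_carrier_sk])

lemmas Car_sum_lessThan [simp] = Car_sum[of "{..<m}" for m, unfolded lessThan_iff]

lemma Car_one [simp]: "sk_one \<in> Car"
  using n_pos by (simp add: sk_one_def carrier_sk_basis_el valid_key_basic)

text \<open>The type also contains functions of infinite support, on which the product is not
  bilinear; hence the membership premises here and below.\<close>

lemma mul_add:
  "f \<in> Car \<Longrightarrow> g \<in> Car \<Longrightarrow> h \<in> Car \<Longrightarrow> (f + g) \<odot> h = f \<odot> h + g \<odot> h"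
  "f \<in> Car \<Longrightarrow> g \<in> Car \<Longrightarrow> h \<in> Car \<Longrightarrow> h \<odot> (f + g) = h \<odot> f + h \<odot> g"
  by (simp_all add: sk_mult_add_left sk_mult_add_right carrier_sk_finite_supp)

lemma mul_smul [simp]:
  "f \<in> Car \<Longrightarrow> h \<in> Car \<Longrightarrow> smul a f \<odot> h = smul a (f \<odot> h)"
  "f \<in> Car \<Longrightarrow> h \<in> Car \<Longrightarrow> f \<odot> smul a h = smul a (f \<odot> h)"
  by (simp_all add: carrier_sk_finite_supp)

lemma mul_sum:
  assumes "\<And>i. i \<in> A \<Longrightarrow> F i \<in> Car" "h \<in> Car"
  shows "sum F A \<odot> h = (\<Sum>i\<in>A. F i \<odot> h)" "h \<odot> sum F A = (\<Sum>i\<in>A. h \<odot> F i)"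
  using assms by (induction A rule: infinite_finite_induct) (simp_all add: mul_add)

lemmas mul_sum_lessThan = mul_sum[of "{..<m}" for m, unfolded lessThan_iff]

lemma lin_comb_mul_lin_comb:
  assumes "\<And>i. i < l \<Longrightarrow> Y i \<in> Car" "\<And>i. i < m \<Longrightarrow> Z i \<in> Car"
  shows "(\<Sum>u<l. smul (p u) (Y u)) \<odot> (\<Sum>v<m. smul (q v) (Z v))
    = (\<Sum>u<l. \<Sum>v<m. smul (p u * q v) (Y u \<odot> Z v))"
proof -
  have "(\<Sum>u<l. smul (p u) (Y u)) \<odot> (\<Sum>v<m. smul (q v) (Z v))
    = (\<Sum>u<l. smul (p u) (Y u) \<odot> (\<Sum>v<m. smul (q v) (Z v)))"
    using assms by (intro mul_sum_lessThan) simp_all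
  also have "\<dots> = (\<Sum>u<l. \<Sum>v<m. smul (p u * q v) (Y u \<odot> Z v))"
    using assms by (intro sum.cong refl) (simp add: mul_sum_lessThan elt.scale_sum_right mult.commute)
  finally show ?thesis .
qed

lemma mul_assoc:
  "f \<in> Car \<Longrightarrow> g \<in> Car \<Longrightarrow> h \<in> Car \<Longrightarrow> f \<odot> g \<odot> h = f \<odot> (g \<odot> h)"
  by (simp add: sk_mult_assoc[OF n_pos] carrier_sk_finite_supp)

lemma mul_one [simp]: "f \<in> Car \<Longrightarrow> sk_one \<odot> f = f" "f \<in> Car \<Longrightarrow> f \<odot> sk_one = f"
  by (simp_all add: sk_one_left sk_one_right)

text \<open>\<open>X i\<close>, \<open>SQ i\<close>, \<open>SG g\<close> stand for \<open>x\<^sub>i\<close>, \<open>x\<^sub>i\<^sup>2\<close>, \<open>\<sigma>\<^sup>g\<close>.\<close>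

definition X :: "nat \<Rightarrow> 'a elt" where "X i = basis_el (var_exp i, 0)"
definition SQ :: "nat \<Rightarrow> 'a elt" where "SQ i = basis_el (\<lambda>j. 2 * var_exp i j, 0)"
definition SG :: "nat \<Rightarrow> 'a elt" where "SG g = basis_el (\<lambda>_. 0, g)"

lemma Car_gens [simp]: "i < n \<Longrightarrow> X i \<in> Car" "i < n \<Longrightarrow> SQ i \<in> Car" "g < n \<Longrightarrow> SG g \<in> Car"
  by (simp_all add: X_def SQ_def SG_def carrier_sk_basis_el valid_key_basic)

lemma SQ_mul_basis_el:
  assumes "valid_key n (a, g)"
  shows "SQ u \<odot> basis_el (a, g) = basis_el (\<lambda>i. 2 * var_exp u i + a i, g)"
  using assms
  by (simp add: SQ_def sk_mult_basis_el key_sign_def key_mult_def act_sign_0 shift_0 valid_key_def)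

lemma basis_el_mul_SQ:
  assumes "valid_key n (a, g)" "u < n"
  shows "basis_el (a, g) \<odot> SQ u = basis_el (\<lambda>i. 2 * var_exp ((u + g) mod n) i + a i, g)"
  using assms
  by (simp add: SQ_def sk_mult_basis_el key_sign_def key_mult_def shift_double shift_var_exp valid_key_def
      add.commute)

text \<open>For \<open>u\<close> \<noteq> \<open>v\<close> exactly one of the two products has to be
  reordered, so the signs cancel.\<close>

lemma X_anticommute:
  assumes "u < n" "v < n"
  shows "X u \<odot> X v + X v \<odot> X u = (if u = v then smul 2 (SQ u) else 0)"
proof -
  have "\<forall>i\<ge>n. var_exp u i = 0" "\<forall>i\<ge>n. var_exp v i = 0" using assms by (auto simp: var_exp_def)
  then have "X u \<odot> X v + X v \<odot> X u
     = smul ((if v < u then -1 else 1) + (if u < v then -1 else 1))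
         (basis_el (\<lambda>i. var_exp u i + var_exp v i, 0))"
    unfolding elt.scale_left_distrib using assms
    by (simp add: X_def sk_mult_basis_el key_sign_def key_mult_def act_sign_0 shift_0 mon_sign_var_exp
        add.commute del: elt.scale_minus_left elt.scale_one)
  also have "\<dots> = (if u = v then smul 2 (SQ u) else 0)"
    by (auto simp: SQ_def mult_2)
  finally show ?thesis .
qed

lemma SG_mul_X: "g < n \<Longrightarrow> i < n \<Longrightarrow> SG g \<odot> X i = X ((i + g) mod n) \<odot> SG g"
  by (simp add: SG_def X_def sk_mult_basis_el key_sign_def key_mult_def shift_var_exp)

lemma SG_mul_SQ: "g < n \<Longrightarrow> i < n \<Longrightarrow> SG g \<odot> SQ i = SQ ((i + g) mod n) \<odot> SG g"
  by (simp add: SG_def SQ_def sk_mult_basis_el key_sign_def key_mult_def shift_double shift_var_exp)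

lemma SQ_mul_X: "u < n \<Longrightarrow> v < n \<Longrightarrow> SQ u \<odot> X v = X v \<odot> SQ u"
  by (simp add: X_def SQ_mul_basis_el basis_el_mul_SQ valid_key_basic)

lemma SQ_mul_SQ: "u < n \<Longrightarrow> v < n \<Longrightarrow> SQ u \<odot> SQ v = SQ v \<odot> SQ u"
  using SQ_mul_basis_el[OF valid_key_basic(2), of v] basis_el_mul_SQ[OF valid_key_basic(2), of v u]
  by (simp add: SQ_def)

lemma w_power_n: "w ^ n = 1"
  using prim by (simp add: primitive_root_of_unity_def)

lemma w_power_mod: "w ^ (i mod n * j) = w ^ (i * j)"
proof -
  have "w ^ (i * j) = w ^ ((n * (i div n) + i mod n) * j)" by simp
  also have "\<dots> = (w ^ n) ^ (i div n * j) * w ^ (i mod n * j)"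
    by (simp only: distrib_right power_add power_mult mult.assoc)
  finally show ?thesis by (simp add: w_power_n)
qed

text \<open>Generic in the family \<open>Y\<close>, so that one computation serves both the
  variables (\<open>b\<close>) and their squares (\<open>c\<close>).\<close>

definition fourier :: "(nat \<Rightarrow> 'a elt) \<Rightarrow> nat \<Rightarrow> 'a elt" where
  "fourier Y j = (\<Sum>i<n. smul (w ^ (i * j)) (Y i))"

definition b :: "nat \<Rightarrow> 'a elt" where "b = fourier X"
definition c :: "nat \<Rightarrow> 'a elt" where "c = fourier SQ"

text \<open>The idempotent on which \<open>SG g\<close> acts from the left by the inverse of w^(r
  g).\<close>

definition e :: "nat \<Rightarrow> 'a elt" where
  "e r = smul (1 / of_nat n) (\<Sum>g<n. smul (w ^ (r * g)) (SG g))"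

lemma Car_fourier: "(\<And>i. i < n \<Longrightarrow> Y i \<in> Car) \<Longrightarrow> fourier Y j \<in> Car"
  by (simp add: fourier_def)

lemma Car_bce [simp]: "b j \<in> Car" "c j \<in> Car" "e j \<in> Car"
  by (simp_all add: b_def c_def e_def Car_fourier)

lemma fourier_mod: "i mod n = j mod n \<Longrightarrow> fourier Y i = fourier Y j"
  unfolding fourier_def by (metis w_power_mod mult.commute)

lemma c_mod: "i mod n = j mod n \<Longrightarrow> c i = c j"
  unfolding c_def by (rule fourier_mod)

lemma e_mod: "i mod n = j mod n \<Longrightarrow> e i = e j"
  unfolding e_def by (metis w_power_mod)

lemma fourier_commute:
  assumes "\<And>i. i < n \<Longrightarrow> Y i \<in> Car" "\<And>i. i < n \<Longrightarrow> Z i \<in> Car"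
    and "\<And>u v. u < n \<Longrightarrow> v < n \<Longrightarrow> Y u \<odot> Z v = Z v \<odot> Y u"
  shows "fourier Y i \<odot> fourier Z j = fourier Z j \<odot> fourier Y i"
proof -
  have "fourier Y i \<odot> fourier Z j
      = (\<Sum>u<n. \<Sum>v<n. smul (w ^ (u * i) * w ^ (v * j)) (Y u \<odot> Z v))"
    using assms(1,2) by (simp add: fourier_def lin_comb_mul_lin_comb)
  also have "\<dots> = (\<Sum>v<n. \<Sum>u<n. smul (w ^ (v * j) * w ^ (u * i)) (Z v \<odot> Y u))"
    using assms(3) by (subst sum.swap) (simp add: mult.commute)
  also have "\<dots> = fourier Z j \<odot> fourier Y i"
    using assms(1,2) by (simp add: fourier_def lin_comb_mul_lin_comb)
  finally show ?thesis .
qed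

lemma c_mul_b: "c k \<odot> b j = b j \<odot> c k"
  unfolding b_def c_def by (rule fourier_commute) (simp_all add: SQ_mul_X)

lemma c_mul_c: "c k \<odot> c j = c j \<odot> c k"
  unfolding c_def by (rule fourier_commute) (simp_all add: SQ_mul_SQ)

text \<open>Exchanging the summations in the second product pairs each
  \<open>X u \<odot> X v\<close> with its reverse; only the diagonal survives, with weights w^(u (i
  + j)).\<close>

lemma b_anticommute: "b i \<odot> b j + b j \<odot> b i = smul 2 (c (i + j))"
proof -
  have 1: "b i \<odot> b j = (\<Sum>u<n. \<Sum>v<n. smul (w ^ (u * i) * w ^ (v * j)) (X u \<odot> X v))" for i j
    by (simp add: b_def fourier_def lin_comb_mul_lin_comb)
  have "b i \<odot> b j + b j \<odot> b i
      = (\<Sum>u<n. \<Sum>v<n. smul (w ^ (u * i) * w ^ (v * j)) (X u \<odot> X v + X v \<odot> X u))"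
    unfolding 1 by (subst (2) sum.swap) (simp add: elt.scale_right_distrib sum.distrib mult.commute)
  also have "\<dots> = (\<Sum>u<n. \<Sum>v<n. if u = v then smul (w ^ (u * i) * w ^ (u * j)) (smul 2 (SQ u)) else 0)"
    by (intro sum.cong refl) (simp add: X_anticommute)
  also have "\<dots> = smul 2 (c (i + j))"
    by (simp add: c_def fourier_def elt.scale_sum_right power_add distrib_left mult_ac)
  finally show ?thesis .
qed

text \<open>Moving \<open>SG g\<close> past \<open>Y i\<close> raises the index by g. The
  substitution of i + g for i absorbs the factor w^(j g) that distinguishes \<open>e (r + j)\<close>
  from \<open>e r\<close>.\<close>

lemma e_mul_fourier:
  assumes Y: "\<And>i. i < n \<Longrightarrow> Y i \<in> Car"
    and SG: "\<And>g i. g < n \<Longrightarrow> i < n \<Longrightarrow> SG g \<odot> Y i = Y ((i + g) mod n) \<odot> SG g"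
  shows "e (r + j) \<odot> fourier Y j = fourier Y j \<odot> e r"
proof -
  have Y': "Y (i mod n) \<in> Car" for i using Y n_pos by simp
  have "e (r + j) \<odot> fourier Y j = smul (1 / of_nat n)
     (\<Sum>g<n. \<Sum>i<n. smul (w ^ ((r + j) * g) * w ^ (i * j)) (SG g \<odot> Y i))"
    using Y by (simp add: e_def fourier_def lin_comb_mul_lin_comb)
  also have "(\<Sum>i<n. smul (w ^ ((r + j) * g) * w ^ (i * j)) (SG g \<odot> Y i))
     = (\<Sum>i<n. smul (w ^ (r * g) * w ^ (i * j)) (Y i \<odot> SG g))" if "g < n" for g
  proof -
    have "(\<Sum>i<n. smul (w ^ (r * g) * w ^ (i * j)) (Y i \<odot> SG g))
       = (\<Sum>i<n. smul (w ^ (r * g) * w ^ ((i + g) mod n * j)) (Y ((i + g) mod n) \<odot> SG g))"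
      by (rule sum.reindex_bij_betw[OF bij_betw_rotate[OF n_pos], symmetric])
    also have "\<dots> = (\<Sum>i<n. smul (w ^ ((r + j) * g) * w ^ (i * j)) (SG g \<odot> Y i))"
      using that by (intro sum.cong refl) (simp add: SG w_power_mod, simp add: power_add[symmetric] algebra_simps)
    finally show ?thesis by simp
  qed
  then have "(\<Sum>g<n. \<Sum>i<n. smul (w ^ ((r + j) * g) * w ^ (i * j)) (SG g \<odot> Y i))
     = (\<Sum>g<n. \<Sum>i<n. smul (w ^ (r * g) * w ^ (i * j)) (Y i \<odot> SG g))" by simp
  also have "\<dots> = (\<Sum>i<n. \<Sum>g<n. smul (w ^ (i * j) * w ^ (r * g)) (Y i \<odot> SG g))"
    by (subst sum.swap) (simp add: mult.commute)
  also have "smul (1 / of_nat n) \<dots> = fourier Y j \<odot> e r"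
    using Y by (simp add: e_def fourier_def lin_comb_mul_lin_comb)
  finally show ?thesis .
qed

lemma e_mul_b: "e (r + j) \<odot> b j = b j \<odot> e r"
  unfolding b_def by (rule e_mul_fourier) (simp_all add: SG_mul_X)

lemma e_mul_c: "e (r + j) \<odot> c j = c j \<odot> e r"
  unfolding c_def by (rule e_mul_fourier) (simp_all add: SG_mul_SQ)

lemma e_zero: "e 0 = e0 n"
proof
  fix k :: key
  have "e 0 k = (1 / of_nat n) * (\<Sum>g<n. if k = (\<lambda>_. 0, g) then 1 else 0)"
    by (simp add: e_def elt_apply SG_def basis_el_def)
  also have "\<dots> = e0 n k" by (cases k) (auto simp: e0_def)
  finally show "e 0 k = e0 n k" .
qed

lemma sum_e: "(\<Sum>r<n. e r) = sk_one"
proof -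
  have "(\<Sum>r<n. e r) = smul (1 / of_nat n) (\<Sum>g<n. smul (\<Sum>r<n. (w ^ g) ^ r) (SG g))"
    unfolding e_def elt.scale_sum_right elt.scale_sum_left
    by (subst sum.swap) (simp add: power_mult[symmetric] mult.commute)
  also have "(\<Sum>g<n. smul (\<Sum>r<n. (w ^ g) ^ r) (SG g)) = (\<Sum>g<n. if g = 0 then smul (of_nat n) (SG 0) else 0)"
    unfolding sum_powers_primitive_root[OF prim]
    by (intro sum.cong refl) (auto dest: dvd_imp_le)
  finally show ?thesis using n_pos by (simp add: SG_def sk_one_def)
qed

text \<open>Fourier inversion; \<open>n - i\<close> stands for the residue of -i among the
  naturals.\<close>

lemma SQ_eq_sum_c:
  assumes "i < n"
  shows "SQ i = (\<Sum>k<n. smul (w ^ ((n - i) * k) / of_nat n) (c k))"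
proof -
  have "(\<Sum>k<n. smul (w ^ ((n - i) * k) / of_nat n) (c k))
     = (\<Sum>u<n. smul ((\<Sum>k<n. (w ^ (n - i + u)) ^ k) / of_nat n) (SQ u))"
    unfolding c_def fourier_def elt.scale_sum_right elt.scale_sum_left sum_divide_distrib
    by (subst sum.swap) (simp add: power_mult[symmetric] power_add[symmetric] algebra_simps)
  also have "\<dots> = (\<Sum>u<n. if u = i then SQ i else 0)"
  proof (intro sum.cong refl)
    fix u assume "u \<in> {..<n}"
    then have "n dvd n - i + u \<longleftrightarrow> u = i"
    proof -
      have "n dvd n - i + u \<Longrightarrow> u = i"
      proof -
        assume "n dvd n - i + u"
        then obtain t where t: "n - i + u = n * t" by blast
        \<comment> \<open>The number n - i + u lies strictly between 0 and 2 n, so n is the only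
          multiple it can be.\<close>
        have "0 < n * t" using t assms by linarith
        moreover have "n * t < n * 2" using t \<open>u \<in> {..<n}\<close> unfolding lessThan_iff by linarith
        ultimately have "t = 1" by simp
        then show "u = i" using t assms by simp
      qed
      then show ?thesis using assms by auto
    qed
    then show "smul ((\<Sum>k<n. (w ^ (n - i + u)) ^ k) / of_nat n) (SQ u) = (if u = i then SQ i else 0)"
      unfolding sum_powers_primitive_root[OF prim] using n_pos by simp
  qed
  finally show ?thesis using assms by simp
qed

end

section \<open>Nilpotency modulo the ideal\<close>

context skew_fourier
begin

lemma Car_e0 [simp]: "e0 n \<in> Car"
  using Car_bce(3)[of 0] by (simp add: e_zero)

lemma I_eq_span: "I = elt.span {r \<odot> e0 n \<odot> s | r s. r \<in> Car \<and> s \<in> Car}"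
  by (simp add: ideal_e0_def lin_span_eq_span)

lemma subspace_I: "elt.subspace I"
  by (simp add: I_eq_span elt.subspace_span)

lemma I_base: "r \<in> Car \<Longrightarrow> s \<in> Car \<Longrightarrow> r \<odot> e0 n \<odot> s \<in> I"
  unfolding I_eq_span by (rule elt.span_base) blast

text \<open>The elements that \<open>t\<close> multiplies into \<open>I\<close> form a subspace
  containing the spanning products. Membership in \<open>Car\<close> is carried along because
  linearity of the product requires it.\<close>

lemma I_mul_left:
  assumes "f \<in> I" "t \<in> Car"
  shows "t \<odot> f \<in> I"
proof -
  have "I \<subseteq> {f \<in> Car. t \<odot> f \<in> I}"
    unfolding I_eq_span
  proof (rule elt.span_minimal, safe)
    fix r s assume "r \<in> Car" "s \<in> Car"
    then show "r \<odot> e0 n \<odot> s \<in> Car" by simp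
    have "t \<odot> (r \<odot> e0 n \<odot> s) = (t \<odot> r) \<odot> e0 n \<odot> s"
      using \<open>r \<in> Car\<close> \<open>s \<in> Car\<close> assms(2) by (simp add: mul_assoc)
    then show "t \<odot> (r \<odot> e0 n \<odot> s) \<in> elt.span {r \<odot> e0 n \<odot> s |r s. r \<in> Car \<and> s \<in> Car}"
      using I_base \<open>r \<in> Car\<close> \<open>s \<in> Car\<close> assms(2) by (simp flip: I_eq_span)
  next
    show "elt.subspace {f \<in> Car. t \<odot> f \<in> elt.span {r \<odot> e0 n \<odot> s |r s. r \<in> Car \<and> s \<in> Car}}"
      using subspace_I assms(2) unfolding I_eq_span[symmetric]
      by (auto simp: elt.subspace_def mul_add)
  qed
  then show ?thesis using assms(1) by blast
qed

lemma I_mul_right: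
  assumes "f \<in> I" "t \<in> Car"
  shows "f \<odot> t \<in> I"
proof -
  have "I \<subseteq> {f \<in> Car. f \<odot> t \<in> I}"
    unfolding I_eq_span
  proof (rule elt.span_minimal, safe)
    fix r s assume "r \<in> Car" "s \<in> Car"
    then show "r \<odot> e0 n \<odot> s \<in> Car" by simp
    have "r \<odot> e0 n \<odot> s \<odot> t = r \<odot> e0 n \<odot> (s \<odot> t)"
      using \<open>r \<in> Car\<close> \<open>s \<in> Car\<close> assms(2) by (simp add: mul_assoc)
    then show "r \<odot> e0 n \<odot> s \<odot> t \<in> elt.span {r \<odot> e0 n \<odot> s |r s. r \<in> Car \<and> s \<in> Car}"
      using I_base \<open>r \<in> Car\<close> \<open>s \<in> Car\<close> assms(2) by (simp flip: I_eq_span)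
  next
    show "elt.subspace {f \<in> Car. f \<odot> t \<in> elt.span {r \<odot> e0 n \<odot> s |r s. r \<in> Car \<and> s \<in> Car}}"
      using subspace_I assms(2) unfolding I_eq_span[symmetric]
      by (auto simp: elt.subspace_def mul_add)
  qed
  then show ?thesis using assms(1) by blast
qed

text \<open>The overloaded product and power on functions are pointwise, so powers in the algebra
  get their own recursion.\<close>

fun cpow :: "nat \<Rightarrow> nat \<Rightarrow> 'a elt" where
  "cpow k 0 = sk_one"
| "cpow k (Suc m) = c k \<odot> cpow k m"

lemma Car_cpow [simp]: "cpow k m \<in> Car"
  by (induction m) simp_all

lemma cpow_add: "cpow k (l + m) = cpow k l \<odot> cpow k m"
  by (induction l) (simp_all add: mul_assoc)

lemma cpow_mul_commute:
  assumes "f \<in> Car" "c k \<odot> f = f \<odot> c k"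
  shows "cpow k m \<odot> f = f \<odot> cpow k m"
proof (induction m)
  case (Suc m)
  have "cpow k (Suc m) \<odot> f = c k \<odot> (f \<odot> cpow k m)" using assms Suc by (simp add: mul_assoc)
  also have "\<dots> = f \<odot> cpow k (Suc m)" using assms by (simp flip: mul_assoc)
  finally show ?case .
qed (simp add: assms)

section \<open>Good residues and nilpotency of \<open>c k\<close>\<close>

definition good :: "nat \<Rightarrow> nat \<Rightarrow> bool" where
  "good k r \<longleftrightarrow> (\<exists>m. cpow k m \<odot> e r \<in> I)"

lemma cpow_mul_e_mono:
  assumes "cpow k m \<odot> e r \<in> I" "m \<le> l"
  shows "cpow k l \<odot> e r \<in> I"
proof -
  have "cpow k l \<odot> e r = cpow k (l - m) \<odot> (cpow k m \<odot> e r)"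
    using assms(2) by (simp add: mul_assoc[symmetric] cpow_add[symmetric])
  then show ?thesis using I_mul_left[OF assms(1)] by simp
qed

lemma good_mod: "r mod n = s mod n \<Longrightarrow> good k r \<Longrightarrow> good k s"
  using e_mod[of r s] by (simp add: good_def)

lemma good_0: "good k 0"
  unfolding good_def using I_base[of sk_one sk_one] by (intro exI[of _ 0]) (simp add: e_zero)

text \<open>One further factor \<open>c k\<close>, moved to the right across the idempotent, turns
  \<open>e r\<close> into \<open>e (r + k)\<close>.\<close>

lemma good_shift:
  assumes "good k (r + k)"
  shows "good k r"
proof -
  obtain m where m: "cpow k m \<odot> e (r + k) \<in> I" using assms by (auto simp: good_def)
  have "cpow k (m + 1) \<odot> e r = cpow k m \<odot> e (r + k) \<odot> c k"
    by (simp only: cpow_add cpow.simps One_nat_def) (simp add: mul_assoc e_mul_c)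
  then have "cpow k (m + 1) \<odot> e r \<in> I" using I_mul_right[OF m] by simp
  then show ?thesis unfolding good_def by blast
qed

text \<open>\<open>b j\<close> carries \<open>e r\<close> to \<open>e (r + j)\<close> and the power
  of \<open>c k\<close> commutes past \<open>b i\<close>, so the element known to lie in
  \<open>I\<close> ends up between \<open>b i\<close> and \<open>b j\<close>.\<close>

lemma cpow_mul_b_mul_b:
  assumes "cpow k m \<odot> e (r + j) \<in> I"
  shows "cpow k m \<odot> (b i \<odot> b j) \<odot> e r \<in> I"
proof -
  have "cpow k m \<odot> (b i \<odot> b j) \<odot> e r = (cpow k m \<odot> b i) \<odot> (b j \<odot> e r)"
    by (simp add: mul_assoc)
  also have "\<dots> = b i \<odot> (cpow k m \<odot> e (r + j)) \<odot> b j"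
    by (simp add: mul_assoc cpow_mul_commute[OF _ c_mul_b] flip: e_mul_b)
  finally show ?thesis using I_mul_right[OF I_mul_left[OF assms]] by simp
qed

lemma good_pair:
  assumes "(i + j) mod n = k mod n" "good k (r + i)" "good k (r + j)"
  shows "good k r"
proof -
  obtain l m where lm: "cpow k l \<odot> e (r + i) \<in> I" "cpow k m \<odot> e (r + j) \<in> I"
    using assms by (auto simp: good_def)
  define N where "N = l + m"
  have N: "cpow k N \<odot> e (r + i) \<in> I" "cpow k N \<odot> e (r + j) \<in> I"
    using lm by (auto intro: cpow_mul_e_mono simp: N_def)
  have "cpow k (N + 1) \<odot> e r = cpow k N \<odot> c k \<odot> e r"
    by (simp only: cpow_add cpow.simps One_nat_def) simp
  \<comment> \<open>Division by 2 is possible in characteristic zero.\<close>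
  also have "c k = smul (1/2) (b i \<odot> b j + b j \<odot> b i)"
    using c_mod[OF assms(1)] by (simp add: b_anticommute)
  also have "cpow k N \<odot> smul (1/2) (b i \<odot> b j + b j \<odot> b i) \<odot> e r
      = smul (1/2) (cpow k N \<odot> (b i \<odot> b j) \<odot> e r + cpow k N \<odot> (b j \<odot> b i) \<odot> e r)"
    by (simp add: mul_add)
  also have "\<dots> \<in> I"
    by (intro elt.subspace_scale[OF subspace_I] elt.subspace_add[OF subspace_I]
        cpow_mul_b_mul_b N)
  finally show ?thesis unfolding good_def by blast
qed

text \<open>After \<open>t\<close> steps of length \<open>k\<close> the residue becomes 0, which is
  good; \<open>good_shift\<close> leads back to \<open>r\<close>.\<close>

lemma good_of_multiple:
  assumes "n dvd r + t * k"
  shows "good k r"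
  using assms
proof (induction t arbitrary: r)
  case 0
  then show ?case using good_0[of k] by (auto intro: good_mod[of 0])
next
  case (Suc t)
  then have "n dvd (r + k) + t * k" by (simp add: algebra_simps)
  then show ?case by (rule good_shift[OF Suc.IH])
qed

text \<open>\<open>good_pair\<close> with i = r and j congruent to k - r, written as k + (n - 1) r
  to stay within the naturals.\<close>

lemma good_half:
  assumes "good k (2 * r)"
  shows "good k r"
proof (rule good_pair)
  show "(r + (k + (n - 1) * r)) mod n = k mod n"
  proof -
    have eq: "r + (k + (n - 1) * r) = k + n * r" using n_pos by (cases n) auto
    show ?thesis unfolding eq by simp
  qed
  show "good k (r + r)" using assms by (simp add: mult_2)
  \<comment> \<open>The residue r + j is congruent to k, and n - 1 further steps of length k end in
    a multiple of n.\<close>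
  have "r + (k + (n - 1) * r) + (n - 1) * k = n * (k + r)"
    using n_pos by (cases n) (auto simp: algebra_simps)
  then show "good k (r + (k + (n - 1) * r))"
    by (intro good_of_multiple[of _ "n - 1"]) simp
qed

lemma all_good:
  assumes "gcd k n = 2 ^ v"
  shows "good k r"
proof -
  have "good k (2 ^ v * r)"
  proof -
    \<comment> \<open>Bezout in this form makes 2^v congruent to -y k modulo n, so that 2^v r is
      reached from 0 by steps of length k. Halving v times then gives r itself.\<close>
    obtain x y where "n * x = k * y + gcd n k" using bezout_nat[of n k] n_pos by auto
    then have "2 ^ v * r + (y * r) * k = n * (x * r)"
      using assms by (simp add: gcd.commute mult.assoc[symmetric]) (simp add: algebra_simps)
    then show ?thesis by (intro good_of_multiple[of _ "y * r"]) simp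
  qed
  then show ?thesis
  proof (induction v)
    case (Suc v)
    then have "good k (2 * (2 ^ v * r))" by (simp add: mult.assoc)
    then show ?case by (rule Suc.IH[OF good_half])
  qed simp
qed

lemma ex_cpow_in_I:
  assumes "gcd k n = 2 ^ v"
  shows "\<exists>m. cpow k m \<in> I"
proof -
  obtain m where m: "\<And>r. cpow k (m r) \<odot> e r \<in> I"
    using all_good[OF assms] unfolding good_def by metis
  \<comment> \<open>One exponent that works for all the idempotents at once; these sum to the
    unit.\<close>
  define N where "N = (\<Sum>r<n. m r)"
  have "cpow k N \<odot> e r \<in> I" if "r < n" for r
    using that by (intro cpow_mul_e_mono[OF m]) (auto simp: N_def intro: member_le_sum)
  then have "(\<Sum>r<n. cpow k N \<odot> e r) \<in> I"
    by (intro elt.subspace_sum[OF subspace_I]) auto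
  also have "(\<Sum>r<n. cpow k N \<odot> e r) = cpow k N"
    by (simp flip: mul_sum_lessThan add: sum_e)
  finally show ?thesis by blast
qed

lemma ex_uniform_cpow_in_I: "\<exists>m. \<forall>k\<in>phi2 n. cpow k m \<in> I"
proof -
  have "\<forall>k\<in>phi2 n. \<exists>m. cpow k m \<in> I" using ex_cpow_in_I by (auto simp: phi2_def)
  then obtain m where m: "\<And>k. k \<in> phi2 n \<Longrightarrow> cpow k (m k) \<in> I" by metis
  have fin: "finite (phi2 n)" by (rule finite_subset[of _ "{..n}"]) (auto simp: phi2_def)
  have "cpow k (\<Sum>k\<in>phi2 n. m k) \<in> I" if k: "k \<in> phi2 n" for k
  proof -
    have "m k \<le> (\<Sum>k\<in>phi2 n. m k)" using k fin by (intro member_le_sum) auto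
    then have "cpow k (\<Sum>k\<in>phi2 n. m k) = cpow k ((\<Sum>k\<in>phi2 n. m k) - m k) \<odot> cpow k (m k)"
      by (simp flip: cpow_add)
    then show ?thesis using I_mul_left[OF m[OF k]] by simp
  qed
  then show ?thesis by blast
qed

end

section \<open>Growth\<close>

definition total_deg :: "nat \<Rightarrow> (nat \<Rightarrow> nat) \<Rightarrow> nat" where
  "total_deg n a = (\<Sum>i<n. a i)"

context skew_fourier
begin

section \<open>Normal forms over the polynomial ring in the \<open>c k\<close>\<close>

fun cmon :: "nat \<Rightarrow> (nat \<Rightarrow> nat) \<Rightarrow> 'a elt" where
  "cmon 0 \<beta> = sk_one"
| "cmon (Suc l) \<beta> = cpow l (\<beta> l) \<odot> cmon l \<beta>"

lemma Car_cmon [simp]: "cmon l \<beta> \<in> Car"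
  by (induction l) simp_all

lemma cmon_cong: "(\<And>k. k < l \<Longrightarrow> \<beta> k = \<gamma> k) \<Longrightarrow> cmon l \<beta> = cmon l \<gamma>"
  by (induction l) auto

lemma c_mul_cmon:
  assumes "j < l"
  shows "c j \<odot> cmon l \<beta> = cmon l (\<beta>(j := Suc (\<beta> j)))"
  using assms
proof (induction l)
  case (Suc l)
  show ?case
  proof (cases "j = l")
    case True
    have "cmon l (\<beta>(j := Suc (\<beta> j))) = cmon l \<beta>" by (rule cmon_cong) (simp add: True)
    moreover have "(\<beta>(j := Suc (\<beta> j))) l = Suc (\<beta> l)" by (simp add: True)
    ultimately show ?thesis by (simp add: True mul_assoc del: fun_upd_apply)
  next
    case False
    have "c j \<odot> cmon (Suc l) \<beta> = (c j \<odot> cpow l (\<beta> l)) \<odot> cmon l \<beta>" by (simp add: mul_assoc)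
    also have "\<dots> = cpow l (\<beta> l) \<odot> (c j \<odot> cmon l \<beta>)"
      by (simp add: mul_assoc flip: cpow_mul_commute[OF _ c_mul_c])
    finally show ?thesis using Suc False by simp
  qed
qed simp

lemma cpow_mul_cmon:
  assumes "j < l"
  shows "cpow j m \<odot> cmon l \<beta> = cmon l (\<beta>(j := \<beta> j + m))"
proof (induction m)
  case (Suc m)
  have "cpow j (Suc m) \<odot> cmon l \<beta> = c j \<odot> cmon l (\<beta>(j := \<beta> j + m))"
    by (simp only: cpow.simps mul_assoc Suc Car_cpow Car_cmon Car_bce)
  also have "\<dots> = cmon l (\<beta>(j := \<beta> j + Suc m))"
    unfolding c_mul_cmon[OF assms] by (rule arg_cong[where f="cmon l"]) simp
  finally show ?case .
qed simp

text \<open>The square-free monomials times group elements act as module generators over the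
  polynomials in the \<open>c k\<close>. \<open>M\<close> bounds each exponent separately, not their
  sum.\<close>

definition cmon_span :: "nat \<Rightarrow> 'a elt set" where
  "cmon_span M = elt.span {cmon n \<beta> \<odot> basis_el (\<epsilon>, g) | \<beta> \<epsilon> g.
     (\<forall>k<n. \<beta> k \<le> M) \<and> valid_key n (\<epsilon>, g) \<and> (\<forall>i. \<epsilon> i \<le> 1)}"

lemma cmon_span_mono: "M \<le> M' \<Longrightarrow> cmon_span M \<subseteq> cmon_span M'"
  unfolding cmon_span_def by (rule elt.span_mono) (blast intro: order_trans)

lemma c_mul_cmon_span:
  assumes "f \<in> cmon_span M" "j < n"
  shows "c j \<odot> f \<in> cmon_span (Suc M)"
proof -
  have "cmon_span M \<subseteq> {f \<in> Car. c j \<odot> f \<in> cmon_span (Suc M)}"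
    unfolding cmon_span_def[of M]
  proof (rule elt.span_minimal, safe)
    fix \<beta> \<epsilon> g assume \<beta>: "\<forall>k<n. \<beta> k \<le> M" and v: "valid_key n (\<epsilon>, g)" "\<forall>i. \<epsilon> i \<le> 1"
    have Car: "basis_el (\<epsilon>, g) \<in> Car" using v by (simp add: carrier_sk_basis_el)
    then show "cmon n \<beta> \<odot> basis_el (\<epsilon>, g) \<in> Car" by simp
    have "c j \<odot> (cmon n \<beta> \<odot> basis_el (\<epsilon>, g)) = cmon n (\<beta>(j := Suc (\<beta> j))) \<odot> basis_el (\<epsilon>, g)"
      using Car by (simp add: c_mul_cmon[OF assms(2)] flip: mul_assoc)
    also have "\<dots> \<in> cmon_span (Suc M)"
      unfolding cmon_span_def using \<beta> v
      by (intro elt.span_base CollectI exI[of _ "\<beta>(j := Suc (\<beta> j))"] exI[of _ \<epsilon>] exI[of _ g])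
        (auto simp: le_Suc_eq)
    finally show "c j \<odot> (cmon n \<beta> \<odot> basis_el (\<epsilon>, g)) \<in> cmon_span (Suc M)" .
  next
    show "elt.subspace {f \<in> Car. c j \<odot> f \<in> cmon_span (Suc M)}"
      using elt.subspace_span unfolding cmon_span_def
      by (auto simp: elt.subspace_def mul_add)
  qed
  then show ?thesis using assms(1) by blast
qed

lemma SQ_mul_cmon_span:
  assumes "f \<in> cmon_span M" "f \<in> Car" "i < n"
  shows "SQ i \<odot> f \<in> cmon_span (Suc M)"
proof -
  have "SQ i \<odot> f = (\<Sum>k<n. smul (w ^ ((n - i) * k) / of_nat n) (c k \<odot> f))"
    using assms by (simp add: SQ_eq_sum_c mul_sum_lessThan)
  also have "\<dots> \<in> cmon_span (Suc M)"
    using c_mul_cmon_span[OF assms(1)] unfolding cmon_span_def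
    by (intro elt.span_sum elt.span_scale) auto
  finally show ?thesis .
qed

text \<open>Splitting off a square of a variable lowers the degree by two and, by
  \<open>SQ_mul_cmon_span\<close>, raises the exponent bound by only one.\<close>

lemma basis_el_in_cmon_span:
  assumes "valid_key n (a, g)" "total_deg n a \<le> M"
  shows "basis_el (a, g) \<in> cmon_span M"
  using assms
proof (induction "total_deg n a" arbitrary: a M rule: less_induct)
  case less
  show ?case
  proof (cases "\<forall>i. a i \<le> 1")
    case True
    have "cmon l (\<lambda>_. 0) = sk_one" for l by (induction l) simp_all
    then have "basis_el (a, g) = cmon n (\<lambda>_. 0) \<odot> basis_el (a, g)"
      using less.prems by (simp add: carrier_sk_basis_el)
    also have "\<dots> \<in> cmon_span M"
      unfolding cmon_span_def using True less.prems by (intro elt.span_base) blast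
    finally show ?thesis .
  next
    case False
    then obtain i where "\<not> a i \<le> 1" by blast
    then have i: "a i \<ge> 2" by simp
    have "i < n"
      by (rule ccontr) (use i less.prems(1) in \<open>auto simp: valid_key_def not_less\<close>)
    define a' where "a' = a(i := a i - 2)"
    have v: "valid_key n (a', g)" using less.prems(1) by (auto simp: valid_key_def a'_def)
    have "total_deg n a = a i + (\<Sum>j\<in>{..<n} - {i}. a j)"
      using \<open>i < n\<close> by (simp add: total_deg_def sum.remove)
    moreover have "total_deg n a' = (a i - 2) + (\<Sum>j\<in>{..<n} - {i}. a j)"
      using \<open>i < n\<close> by (simp add: total_deg_def sum.remove[of _ i] a'_def)
    ultimately have deg: "total_deg n a = total_deg n a' + 2" using i by simp
    have "basis_el (a', g) \<in> cmon_span (M - 2)"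
      using less.prems deg v by (intro less.hyps) auto
    then have "SQ i \<odot> basis_el (a', g) \<in> cmon_span (Suc (M - 2))"
      using v \<open>i < n\<close> by (intro SQ_mul_cmon_span) (simp_all add: carrier_sk_basis_el)
    moreover have "SQ i \<odot> basis_el (a', g) = basis_el (a, g)"
    proof -
      have "(\<lambda>j. 2 * var_exp i j + a' j) = a" using i by (auto simp: a'_def var_exp_def fun_eq_iff)
      then show ?thesis using v by (simp add: SQ_mul_basis_el)
    qed
    \<comment> \<open>The truncated subtraction is harmless: a monomial with an exponent of at least
      2 forces \<open>M\<close> to be at least 2.\<close>
    moreover have "Suc (M - 2) \<le> M" using deg less.prems by simp
    ultimately show ?thesis using cmon_span_mono by auto
  qed
qed

text \<open>The normal forms that can survive modulo \<open>I\<close>: exponents at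
  \<open>phi2 n\<close> stay below the nilpotency bound \<open>N\<close>, the remaining ones grow
  with \<open>M\<close>. The set \<open>S\<close> encodes a square-free monomial.\<close>

definition cmon_box :: "nat \<Rightarrow> nat \<Rightarrow> 'a elt set" where
  "cmon_box N M = (\<lambda>(\<beta>, S, g). cmon n \<beta> \<odot> basis_el (\<lambda>i. if i \<in> S then 1 else 0, g)) `
     ((\<Pi>\<^sub>E k\<in>{..<n}. if k \<in> phi2 n then {..<N} else {..M}) \<times> Pow {..<n} \<times> {..<n})"

lemma phi2_subset: "phi2 n \<subseteq> {..<n}"
  using n_pos by (auto simp: phi2_def)

lemma finite_cmon_box: "finite (cmon_box N M)"
  unfolding cmon_box_def by (intro finite_imageI finite_cartesian_product finite_PiE) auto

lemma card_cmon_box_le: "card (cmon_box N M) \<le> N ^ card (phi2 n) * 2 ^ n * n * (M + 1) ^ (n - card (phi2 n))"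
proof -
  have "card (cmon_box N M) \<le> card ((\<Pi>\<^sub>E k\<in>{..<n}. if k \<in> phi2 n then {..<N} else {..M}) \<times> Pow {..<n} \<times> {..<n})"
    unfolding cmon_box_def by (intro card_image_le finite_cartesian_product finite_PiE) auto
  also have "\<dots> = (\<Prod>k<n. if k \<in> phi2 n then N else M + 1) * (2 ^ n * n)"
    by (simp add: card_cartesian_product card_PiE card_Pow if_distrib cong: if_cong)
  also have "(\<Prod>k<n. if k \<in> phi2 n then N else M + 1) = N ^ card (phi2 n) * (M + 1) ^ (n - card (phi2 n))"
  proof -
    have "{..<n} \<inter> phi2 n = phi2 n" "{..<n} \<inter> - phi2 n = {..<n} - phi2 n" using phi2_subset by auto
    then show ?thesis
      using phi2_subset finite_subset[OF phi2_subset]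
      by (simp add: prod.If_cases card_Diff_subset)
  qed
  finally show ?thesis by (simp add: mult_ac)
qed

text \<open>A normal form with some exponent at \<open>phi2 n\<close> of at least \<open>N\<close>
  contains the factor \<open>cpow k N\<close> and lies in \<open>I\<close>; every other one is
  already in the box.\<close>

lemma cmon_span_mod_I:
  assumes N: "\<And>k. k \<in> phi2 n \<Longrightarrow> cpow k N \<in> I" and f: "f \<in> cmon_span M"
  shows "\<exists>v\<in>elt.span (cmon_box N M). f - v \<in> I"
proof -
  have "cmon_span M \<subseteq> {f. \<exists>v\<in>elt.span (cmon_box N M). f - v \<in> I}"
    unfolding cmon_span_def
  proof (rule elt.span_minimal, safe)
    fix \<beta> \<epsilon> g assume \<beta>: "\<forall>k<n. \<beta> k \<le> M" and v: "valid_key n (\<epsilon>, g)" "\<forall>i. \<epsilon> i \<le> 1"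
    have Car: "basis_el (\<epsilon>, g) \<in> Car" using v by (simp add: carrier_sk_basis_el)
    show "\<exists>v\<in>elt.span (cmon_box N M). cmon n \<beta> \<odot> basis_el (\<epsilon>, g) - v \<in> I"
    proof (cases "\<exists>k\<in>phi2 n. \<beta> k \<ge> N")
      case True
      then obtain k where k: "k \<in> phi2 n" "\<beta> k \<ge> N" by blast
      then have "k < n" using phi2_subset by auto
      have eq: "cmon n \<beta> = cpow k N \<odot> cmon n (\<beta>(k := \<beta> k - N))"
        using k by (simp add: cpow_mul_cmon[OF \<open>k < n\<close>])
      have "cmon n \<beta> \<odot> basis_el (\<epsilon>, g) \<in> I"
        unfolding eq using Car by (intro I_mul_right[OF I_mul_right[OF N[OF k(1)]]]) simp_all
      then show ?thesis by (intro bexI[of _ 0] elt.span_zero) simp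
    next
      case False
      \<comment> \<open>The product of sets in \<open>cmon_box\<close> consists of extensional
        functions, so the values beyond n are reset.\<close>
      define \<gamma> where "\<gamma> = restrict \<beta> {..<n}"
      define S where "S = {i. \<epsilon> i = 1}"
      have "\<epsilon> = (\<lambda>i. if i \<in> S then 1 else 0)"
        using v(2) by (auto simp: S_def fun_eq_iff le_Suc_eq)
      moreover have "cmon n \<beta> = cmon n \<gamma>" by (rule cmon_cong) (simp add: \<gamma>_def)
      moreover have "S \<subseteq> {..<n}" "g < n" using v(1) by (auto simp: S_def valid_key_def not_le[symmetric])
      moreover have "\<gamma> \<in> (\<Pi>\<^sub>E k\<in>{..<n}. if k \<in> phi2 n then {..<N} else {..M})"
        using False \<beta> by (auto simp: \<gamma>_def not_le)
      ultimately have "cmon n \<beta> \<odot> basis_el (\<epsilon>, g) \<in> cmon_box N M"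
        unfolding cmon_box_def by (intro image_eqI[of _ _ "(\<gamma>, S, g)"]) auto
      then show ?thesis
        using elt.subspace_0[OF subspace_I] by (intro bexI[OF _ elt.span_base]) auto
    qed
  next
    show "elt.subspace {f. \<exists>v\<in>elt.span (cmon_box N M). f - v \<in> I}"
    proof (rule elt.subspaceI)
      show "0 \<in> {f. \<exists>v\<in>elt.span (cmon_box N M). f - v \<in> I}"
        using elt.subspace_0[OF subspace_I] by (auto intro!: bexI[of _ 0] elt.span_zero)
    next
      fix x y assume "x \<in> {f. \<exists>v\<in>elt.span (cmon_box N M). f - v \<in> I}" "y \<in> {f. \<exists>v\<in>elt.span (cmon_box N M). f - v \<in> I}"
      then obtain u v where uv: "u \<in> elt.span (cmon_box N M)" "x - u \<in> I" "v \<in> elt.span (cmon_box N M)" "y - v \<in> I"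
        by blast
      have "(x + y) - (u + v) \<in> I" using elt.subspace_add[OF subspace_I uv(2,4)] by (simp add: algebra_simps)
      then show "x + y \<in> {f. \<exists>v\<in>elt.span (cmon_box N M). f - v \<in> I}"
        using uv elt.span_add by blast
    next
      fix a x assume "x \<in> {f. \<exists>v\<in>elt.span (cmon_box N M). f - v \<in> I}"
      then obtain u where u: "u \<in> elt.span (cmon_box N M)" "x - u \<in> I" by blast
      have "smul a x - smul a u \<in> I"
        using elt.subspace_scale[OF subspace_I u(2)] by (simp add: elt.scale_right_diff_distrib)
      then show "smul a x \<in> {f. \<exists>v\<in>elt.span (cmon_box N M). f - v \<in> I}"
        using u(1) elt.span_scale by blast
    qed
  qed
  then show ?thesis using f by blast
qed

end

section \<open>Words in the generators and their degrees\<close>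

lemma basis_el_inject: "(basis_el k :: 'a::field elt) = basis_el k' \<longleftrightarrow> k = k'"
  by (metis singleton_inject supp_basis_el)

text \<open>The shift only permutes the exponents.\<close>

lemma total_deg_key_mult:
  assumes "n > 0"
  shows "total_deg n (fst (key_mult n x y)) = total_deg n (fst x) + total_deg n (fst y)"
proof -
  have "total_deg n (shift n g a) = (\<Sum>j<n. shift n g a ((j + g) mod n))" for g a
    unfolding total_deg_def by (rule sum.reindex_bij_betw[OF bij_betw_rotate[OF assms], symmetric])
  then have "total_deg n (shift n g a) = total_deg n a" for g a
    by (simp add: total_deg_def shift_rotate)
  then show ?thesis by (simp add: key_mult_def total_deg_def sum.distrib)
qed

lemma gens_skew_cases:
  assumes "x \<in> gens_skew n"
  obtains k where "x = basis_el k" "valid_key n k" "total_deg n (fst k) \<le> 1"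
proof -
  from assms consider g where "g < n" "x = basis_el ((\<lambda>_. 0), g)" | i where "i < n" "x = basis_el (var_exp i, 0)"
    unfolding gens_skew_def by blast
  then show ?thesis
  proof cases
    case 1
    then show ?thesis by (intro that[of "((\<lambda>_. 0), g)"]) (auto simp: valid_key_def total_deg_def)
  next
    case 2
    then show ?thesis by (intro that[of "(var_exp i, 0)"]) (auto simp: valid_key_def var_exp_def total_deg_def)
  qed
qed

lemma word_prod_gens_skew:
  assumes n: "n > 0" and "set ws \<subseteq> gens_skew n"
  shows "\<exists>s k. (word_prod n ws :: 'a::field elt) = smul s (basis_el k) \<and> valid_key n k
    \<and> total_deg n (fst k) \<le> length ws"
  using assms(2)
proof (induction ws)
  case Nil
  show ?case
    using n by (intro exI[of _ 1] exI[of _ "((\<lambda>_. 0), 0)"])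
      (simp add: word_prod_def sk_one_def valid_key_def total_deg_def)
next
  case (Cons x ws)
  obtain s k where sk: "word_prod n ws = smul s (basis_el k)" "valid_key n k" "total_deg n (fst k) \<le> length ws"
    using Cons by auto
  obtain k' where k': "x = basis_el k'" "valid_key n k'" "total_deg n (fst k') \<le> 1"
    using Cons.prems gens_skew_cases[of x n] by auto
  have "word_prod n (x # ws) = smul (s * of_int (key_sign n k' k)) (basis_el (key_mult n k' k))"
    using sk(1) k'(1) by (simp add: word_prod_def sk_mult_basis_el)
  moreover have "total_deg n (fst (key_mult n k' k)) \<le> length (x # ws)"
    using sk(3) k'(3) by (simp add: total_deg_key_mult[OF n])
  ultimately show ?case using valid_key_mult[OF n k'(2) sk(2)] by blast
qed

lemma filt_pow_eq_span: "filt_pow n G m = elt.span {word_prod n ws | ws. length ws = m \<and> set ws \<subseteq> G}"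
  by (simp add: filt_pow_def lin_span_eq_span)

text \<open>Stated for any \<open>G\<close> inside \<open>gens_skew n\<close>, so that it covers the
  generators of \<open>A\<close> as well.\<close>

lemma filt_pow_subset:
  assumes n: "n > 0" and G: "G \<subseteq> gens_skew n"
  shows "filt_pow n G m \<subseteq> elt.span (basis_el ` {k. valid_key n k \<and> total_deg n (fst k) \<le> m} :: 'a::field elt set)"
  unfolding filt_pow_eq_span
proof (rule elt.span_minimal, safe)
  fix ws :: "'a elt list" assume "set ws \<subseteq> G" "m = length ws"
  then obtain s k where "word_prod n ws = smul s (basis_el k)" "valid_key n k" "total_deg n (fst k) \<le> length ws"
    using word_prod_gens_skew[OF n, of ws] G by blast
  then show "word_prod n ws \<in> elt.span (basis_el ` {k. valid_key n k \<and> total_deg n (fst k) \<le> length ws})"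
    by (simp add: elt.span_scale elt.span_base)
qed

lemma filt_pow_Suc:
  assumes "x \<in> G" "f \<in> filt_pow n G m" "finite (supp x)" "\<And>y. y \<in> G \<Longrightarrow> finite (supp y)"
  shows "sk_mult n x f \<in> filt_pow n G (Suc m)"
proof -
  have fin: "finite (supp (word_prod n ws))" if "set ws \<subseteq> G" for ws
    using that by (induction ws) (auto simp: word_prod_def sk_one_def assms)
  have "filt_pow n G m \<subseteq> {f. finite (supp f) \<and> sk_mult n x f \<in> filt_pow n G (Suc m)}"
    unfolding filt_pow_eq_span[of n G m]
  proof (rule elt.span_minimal, safe)
    fix ws assume ws: "set ws \<subseteq> G" "m = length ws"
    then show "finite (supp (word_prod n ws))" by (simp add: fin)
    have "sk_mult n x (word_prod n ws) = word_prod n (x # ws)" by (simp add: word_prod_def)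
    also have "\<dots> \<in> filt_pow n G (Suc (length ws))"
      unfolding filt_pow_eq_span using ws assms(1)
      by (intro elt.span_base CollectI exI[of _ "x # ws"]) auto
    finally show "sk_mult n x (word_prod n ws) \<in> filt_pow n G (Suc (length ws))" .
  next
    show "elt.subspace {f. finite (supp f) \<and> sk_mult n x f \<in> filt_pow n G (Suc m)}"
      using elt.subspace_span assms(3) unfolding filt_pow_eq_span
      by (auto simp: elt.subspace_def sk_mult_add_right)
  qed
  then show ?thesis using assms(2) by blast
qed

lemma finite_bounded_valid_keys: "finite {k. valid_key n k \<and> total_deg n (fst k) \<le> m}"
proof (rule finite_subset)
  show "{k. valid_key n k \<and> total_deg n (fst k) \<le> m}
    \<subseteq> {a. \<forall>i. (i \<in> {..<n} \<longrightarrow> a i \<in> {..m}) \<and> (i \<notin> {..<n} \<longrightarrow> a i = 0)} \<times> {..<n}"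
  proof
    fix k assume k: "k \<in> {k. valid_key n k \<and> total_deg n (fst k) \<le> m}"
    obtain a g where "k = (a, g)" by (rule prod.exhaust)
    with k have v: "valid_key n (a, g)" "total_deg n a \<le> m" by simp_all
    have "a i \<le> m" if "i < n" for i
      using member_le_sum[of i "{..<n}" a] that v by (simp add: total_deg_def)
    then show "k \<in> {a. \<forall>i. (i \<in> {..<n} \<longrightarrow> a i \<in> {..m}) \<and> (i \<notin> {..<n} \<longrightarrow> a i = 0)} \<times> {..<n}"
      using v \<open>k = (a, g)\<close> by (simp add: valid_key_def)
  qed
  show "finite ({a. \<forall>i. (i \<in> {..<n} \<longrightarrow> a i \<in> {..m}) \<and> (i \<notin> {..<n} \<longrightarrow> a i = (0::nat))} \<times> {..<n})"
    by (intro finite_cartesian_product finite_set_of_finite_funs) auto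
qed

section \<open>Lower bound for the growth of \<open>A\<close>\<close>

lemma gens_A_subset: "n > 0 \<Longrightarrow> gens_A n \<subseteq> gens_skew n"
  by (auto simp: gens_A_def gens_skew_def sk_one_def)

lemma basis_el_in_filt_pow_gens_A:
  assumes "n > 0" "valid_key n (a, 0)" "total_deg n a \<le> m"
  shows "(basis_el (a, 0) :: 'a::field elt) \<in> filt_pow n (gens_A n) m"
  using assms(2,3)
proof (induction m arbitrary: a)
  case 0
  have "a i = 0" for i
    using 0 by (cases "i < n") (simp_all add: total_deg_def valid_key_def)
  then have "a = (\<lambda>_. 0)" by blast
  then have "basis_el (a, 0) = word_prod n ([] :: 'a elt list)" by (simp add: word_prod_def sk_one_def)
  also have "\<dots> \<in> filt_pow n (gens_A n) 0"
    unfolding filt_pow_eq_span by (intro elt.span_base) auto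
  finally show ?case .
next
  case (Suc m)
  have fin: "finite (supp y)" if "y \<in> gens_A n" for y :: "'a elt"
    using that by (auto simp: gens_A_def sk_one_def)
  show ?case
  proof (cases "a = (\<lambda>_. 0)")
    case True
    then have "(basis_el (a, 0) :: 'a elt) \<in> filt_pow n (gens_A n) m"
      using Suc.IH assms(1) by (simp add: valid_key_def total_deg_def)
    \<comment> \<open>The words have length exactly Suc m; the generator \<open>sk_one\<close>
      serves as padding.\<close>
    then have "sk_mult n sk_one (basis_el (a, 0) :: 'a elt) \<in> filt_pow n (gens_A n) (Suc m)"
      using fin by (intro filt_pow_Suc) (auto simp: gens_A_def)
    then show ?thesis using Suc.prems by (simp add: sk_one_left carrier_sk_basis_el)
  next
    case False
    then obtain i where i: "a i > 0" by auto
    have "i < n"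
      by (rule ccontr) (use i Suc.prems(1) in \<open>auto simp: valid_key_def not_less\<close>)
    define a' where "a' = a(i := a i - 1)"
    have v: "valid_key n (a', 0)" using Suc.prems(1) by (auto simp: valid_key_def a'_def)
    have km: "key_mult n (var_exp i, 0) (a', 0) = (a, 0)"
      using i v by (auto simp: key_mult_def shift_0 valid_key_def a'_def var_exp_def fun_eq_iff)
    have "total_deg n (var_exp i) = 1" using \<open>i < n\<close> by (simp add: total_deg_def var_exp_def)
    then have "total_deg n a' \<le> m"
      using Suc.prems(2) total_deg_key_mult[OF assms(1), of "(var_exp i, 0)" "(a', 0)"] km by simp
    then have "(basis_el (a', 0) :: 'a elt) \<in> filt_pow n (gens_A n) m" using v by (intro Suc.IH)
    then have "sk_mult n (basis_el (var_exp i, 0)) (basis_el (a', 0) :: 'a elt) \<in> filt_pow n (gens_A n) (Suc m)"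
      using fin \<open>i < n\<close> by (intro filt_pow_Suc) (auto simp: gens_A_def)
    then have mem: "smul (of_int (key_sign n (var_exp i, 0) (a', 0))) (basis_el (a, 0) :: 'a elt)
        \<in> filt_pow n (gens_A n) (Suc m)"
      by (simp add: sk_mult_basis_el km)
    \<comment> \<open>Prepending the variable may introduce a sign, which is its own inverse and so
      can be scaled away.\<close>
    define s :: int where "s = key_sign n (var_exp i, 0) (a', 0)"
    have "s * s = 1"
      by (simp add: s_def key_sign_def act_sign_def mon_sign_def flip: power_mult_distrib power_add)
    then have "smul (of_int s) (smul (of_int s) (basis_el (a, 0))) = (basis_el (a, 0) :: 'a elt)"
      by (simp flip: of_int_mult)
    moreover have "smul (of_int s) (smul (of_int s) (basis_el (a, 0) :: 'a elt)) \<in> filt_pow n (gens_A n) (Suc m)"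
      using mem unfolding filt_pow_eq_span s_def[symmetric] by (rule elt.span_scale)
    ultimately show ?thesis by simp
  qed
qed

text \<open>All monomials with exponents at most m div n have total degree at most m, and distinct
  ones are independent.\<close>

lemma rank_A_ge:
  assumes n: "n > 0"
  shows "(m div n + 1) ^ n \<le> rank_mod {\<lambda>_. 0} (filt_pow n (gens_A n :: 'a::field elt set) m)"
proof -
  define q where "q = m div n"
  define P where "P = (\<Pi>\<^sub>E i\<in>{..<n}. {..q})"
  define h where "h = (\<lambda>\<alpha>. basis_el (\<lambda>i. if i < n then \<alpha> i else 0, 0) :: 'a elt)"
  have inj: "inj_on h P"
  proof (rule inj_onI)
    fix \<alpha> \<beta> assume ab: "\<alpha> \<in> P" "\<beta> \<in> P" "h \<alpha> = h \<beta>"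
    have eq: "(\<lambda>i. if i < n then \<alpha> i else 0) = (\<lambda>i. if i < n then \<beta> i else 0)"
      using ab(3) by (simp add: h_def basis_el_inject)
    have "\<alpha> i = \<beta> i" if "i < n" for i using fun_cong[OF eq, of i] that by simp
    then show "\<alpha> = \<beta>" using ab(1,2) unfolding P_def by (intro PiE_ext) auto
  qed
  have finP: "finite P" by (simp add: P_def finite_PiE)
  have "card (h ` P) = (q + 1) ^ n"
    using inj by (simp add: card_image P_def card_PiE)
  moreover have "card (h ` P) \<le> rank_mod {\<lambda>_. 0} (filt_pow n (gens_A n :: 'a elt set) m)"
  proof (rule card_le_rank_mod)
    show "elt.subspace {\<lambda>_. 0 :: 'a}"
      using elt.subspace_single_0 by (simp add: zero_fun_def)
    show "finite (basis_el ` {k. valid_key n k \<and> total_deg n (fst k) \<le> m} :: 'a elt set)"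
      by (intro finite_imageI finite_bounded_valid_keys)
    show "\<exists>u\<in>elt.span (basis_el ` {k. valid_key n k \<and> total_deg n (fst k) \<le> m}). v - u \<in> {\<lambda>_. 0}"
      if "v \<in> filt_pow n (gens_A n :: 'a elt set) m" for v
      using that filt_pow_subset[OF n gens_A_subset[OF n]]
      by (intro bexI[of _ v]) (auto simp: zero_fun_def)
    show "finite (h ` P)" using finP by simp
    show "h ` P \<subseteq> filt_pow n (gens_A n) m"
    proof safe
      fix \<alpha> assume \<alpha>: "\<alpha> \<in> P"
      have "total_deg n (\<lambda>i. if i < n then \<alpha> i else 0) \<le> (\<Sum>i<n. q)"
        unfolding total_deg_def using \<alpha> by (intro sum_mono) (auto simp: P_def)
      also have "\<dots> \<le> m" by (simp add: q_def)
      finally show "h \<alpha> \<in> filt_pow n (gens_A n) m"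
        unfolding h_def using n by (intro basis_el_in_filt_pow_gens_A) (auto simp: valid_key_def)
    qed
    show "indep_mod {\<lambda>_. 0} (h ` P)"
      unfolding indep_mod_def
    proof (intro allI impI ballI)
      fix d x assume "(\<lambda>k. \<Sum>b\<in>h ` P. d b * b k) \<in> {\<lambda>_. 0}" "x \<in> h ` P"
      then obtain \<alpha> where \<alpha>: "\<alpha> \<in> P" "x = h \<alpha>" and z: "\<And>k. (\<Sum>b\<in>h ` P. d b * b k) = 0"
        by (auto dest: fun_cong)
      \<comment> \<open>Evaluation at the key of \<open>x\<close> annihilates all other basis
        elements and isolates the coefficient \<open>d x\<close>.\<close>
      define k where "k = (\<lambda>i. if i < n then \<alpha> i else 0, 0::nat)"
      have "d b * b k = (if b = x then d x else 0)" if b: "b \<in> h ` P" for b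
      proof -
        obtain k' where "b = basis_el k'" using b by (auto simp: h_def)
        moreover have "x = basis_el k" by (simp add: \<alpha>(2) k_def h_def)
        ultimately show ?thesis by (simp add: basis_el_inject) (simp add: basis_el_def)
      qed
      then have "(\<Sum>b\<in>h ` P. d b * b k) = (\<Sum>b\<in>h ` P. if b = x then d x else 0)"
        by (intro sum.cong refl)
      then show "d x = 0" using z[of k] \<open>x \<in> h ` P\<close> finP by simp
    qed
  qed
  ultimately show ?thesis by (simp add: q_def)
qed

text \<open>The rank is at least (m / n)^n, whose logarithm to base m tends to n. A lower bound
  suffices, as this dimension enters \<open>pertinency\<close> positively.\<close>

lemma GKdim_A_ge:
  assumes "n > 0"
  shows "ereal (real n) \<le> GKdim_A TYPE('a::field) n"
proof -
  define r where "r m = rank_mod {\<lambda>_. 0} (filt_pow n (gens_A n :: 'a elt set) m)" for m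
  have le: "real n * ((ln (real m) - ln (real n)) / ln (real m)) \<le> ln (real (r m)) / ln (real m)"
    if m: "m \<ge> 2" for m
  proof -
    have "real m / real n \<le> real (m div n + 1)"
    proof -
      have "m < n * (m div n + 1)" using assms by (simp add: dividend_less_times_div)
      then have "real m \<le> real n * real (m div n + 1)" by (metis less_imp_le of_nat_le_iff of_nat_mult)
      then show ?thesis using assms by (simp add: field_simps)
    qed
    then have "(real m / real n) ^ n \<le> real (m div n + 1) ^ n" by (intro power_mono) auto
    also have "\<dots> \<le> real (r m)"
      using rank_A_ge[OF assms, of m, where 'a='a] unfolding r_def by (metis of_nat_le_iff of_nat_power)
    finally have "ln ((real m / real n) ^ n) \<le> ln (real (r m))"
      using m assms by (intro ln_mono) auto
    then have "real n * (ln (real m) - ln (real n)) \<le> ln (real (r m))"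
      using m assms by (simp add: ln_realpow ln_div)
    then show ?thesis using m by (simp add: divide_right_mono)
  qed
  have "(\<lambda>m. (ln (real m) - ln (real n)) / ln (real m)) \<longlonglongrightarrow> 1"
    by real_asymp
  then have "(\<lambda>m. real n * ((ln (real m) - ln (real n)) / ln (real m))) \<longlonglongrightarrow> real n * 1"
    by (intro tendsto_mult_left)
  then have "(\<lambda>m. ereal (real n * ((ln (real m) - ln (real n)) / ln (real m)))) \<longlonglongrightarrow> ereal (real n)"
    by simp
  from lim_imp_Limsup[OF _ this]
  have "ereal (real n) = limsup (\<lambda>m. ereal (real n * ((ln (real m) - ln (real n)) / ln (real m))))"
    by simp
  also have "\<dots> \<le> limsup (\<lambda>m. ereal (ln (real (r m)) / ln (real m)))"
    using le by (intro Limsup_mono eventually_sequentiallyI[of 2]) auto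
  finally show ?thesis by (simp add: GKdim_A_def GKdim_quot_def r_def)
qed

section \<open>From polynomial counting bounds to the dimension of the quotient\<close>

lemma limsup_ln_ratio_le:
  fixes r :: "nat \<Rightarrow> nat"
  assumes "\<And>m. r m \<le> K * (m + 1) ^ d"
  shows "limsup (\<lambda>m. ereal (ln (real (r m)) / ln (real m))) \<le> ereal (real d)"
proof -
  \<comment> \<open>The added 1 keeps the logarithm of \<open>C\<close> defined and nonnegative even
    for \<open>K\<close> = 0.\<close>
  define C where "C = real K + 1"
  have le: "ln (real (r m)) / ln (real m) \<le> ln C / ln (real m) + real d * (ln (real m + 1) / ln (real m))"
    if m: "m \<ge> 2" for m
  proof -
    have "ln (real (r m)) \<le> ln C + real d * ln (real m + 1)"
    \<comment> \<open>If the rank is 0, \<open>ln 0\<close> is 0 by convention, and the right-hand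
      side is nonnegative.\<close>
    proof (cases "r m = 0")
      case False
      have "real (r m) \<le> real (K * (m + 1) ^ d)" using assms by (simp only: of_nat_le_iff)
      also have "\<dots> \<le> C * (real m + 1) ^ d" by (simp add: C_def mult_right_mono add.commute)
      finally have "ln (real (r m)) \<le> ln (C * (real m + 1) ^ d)"
        using False by (intro ln_mono) auto
      also have "\<dots> = ln C + real d * ln (real m + 1)"
        by (simp add: C_def ln_mult ln_realpow)
      finally show ?thesis .
    qed (simp add: C_def)
    then have "ln (real (r m)) / ln (real m) \<le> (ln C + real d * ln (real m + 1)) / ln (real m)"
      using m by (simp add: divide_right_mono)
    then show ?thesis by (simp add: add_divide_distrib)
  qed
  have "(\<lambda>m. ln C / ln (real m)) \<longlonglongrightarrow> 0" by real_asymp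
  moreover have "(\<lambda>m. ln (real m + 1) / ln (real m)) \<longlonglongrightarrow> 1" by real_asymp
  ultimately have "(\<lambda>m. ln C / ln (real m) + real d * (ln (real m + 1) / ln (real m))) \<longlonglongrightarrow> 0 + real d * 1"
    by (intro tendsto_add tendsto_mult_left)
  then have "(\<lambda>m. ereal (ln C / ln (real m) + real d * (ln (real m + 1) / ln (real m)))) \<longlonglongrightarrow> ereal (real d)"
    by simp
  then have "limsup (\<lambda>m. ereal (ln C / ln (real m) + real d * (ln (real m + 1) / ln (real m)))) = ereal (real d)"
    by (simp add: lim_imp_Limsup)
  moreover have "limsup (\<lambda>m. ereal (ln (real (r m)) / ln (real m)))
      \<le> limsup (\<lambda>m. ereal (ln C / ln (real m) + real d * (ln (real m + 1) / ln (real m))))"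
    using le by (intro Limsup_mono eventually_sequentiallyI[of 2]) auto
  ultimately show ?thesis by simp
qed

text \<open>Words of length m are combinations of normal forms with exponents at most m, and modulo
  \<open>I\<close> these reduce to a box whose size is polynomial in m of degree n - card (phi2
  n).\<close>

lemma (in skew_fourier) GKdim_skew_quot_le:
  "GKdim_skew_quot TYPE('a) n \<le> ereal (real (n - card (phi2 n)))"
proof -
  obtain N where N: "\<And>k. k \<in> phi2 n \<Longrightarrow> cpow k N \<in> I" using ex_uniform_cpow_in_I by blast
  have "rank_mod I (filt_pow n (gens_skew n) m)
      \<le> N ^ card (phi2 n) * 2 ^ n * n * (m + 1) ^ (n - card (phi2 n))" for m
  proof -
    have "filt_pow n (gens_skew n) m \<subseteq> cmon_span m"
    proof -
      have "elt.span (basis_el ` {k. valid_key n k \<and> total_deg n (fst k) \<le> m}) \<subseteq> cmon_span m"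
      proof (rule elt.span_minimal)
        show "elt.subspace (cmon_span m)" by (simp add: cmon_span_def elt.subspace_span)
      qed (auto intro: basis_el_in_cmon_span)
      then show ?thesis using filt_pow_subset[OF n_pos order_refl] by blast
    qed
    then have "rank_mod I (filt_pow n (gens_skew n) m) \<le> card (cmon_box N m)"
      using cmon_span_mod_I[OF N] by (intro rank_mod_le[OF subspace_I finite_cmon_box]) blast
    also note card_cmon_box_le
    finally show ?thesis .
  qed
  then show ?thesis unfolding GKdim_skew_quot_def GKdim_quot_def by (rule limsup_ln_ratio_le)
qed

theorem theorem0p7:
  fixes K :: "'a::field_char_0 itself" and n :: nat
  assumes "algebraically_closed K" and "n \<ge> 2"
  shows "ereal (real (card (phi2 n))) \<le> pertinency K n"
proof -
  have "algebraically_closed TYPE('a)" using assms(1) by (simp add: algebraically_closed_def)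
  then obtain w :: 'a where "primitive_root_of_unity n w"
    using primitive_root_of_unity_exists[of n, where 'a='a] assms(2) by auto
  then interpret skew_fourier n w using assms(2) by unfold_locales auto
  \<comment> \<open>Makes the natural subtraction in \<open>GKdim_skew_quot_le\<close> exact, so
    that the two dimension bounds differ by precisely card (phi2 n).\<close>
  have "card (phi2 n) \<le> n" using card_mono[OF _ phi2_subset] by simp
  then have "ereal (real (card (phi2 n))) = ereal (real n) - ereal (real (n - card (phi2 n)))"
    by (simp add: of_nat_diff)
  also have "\<dots> \<le> GKdim_A TYPE('a) n - GKdim_skew_quot TYPE('a) n"
    by (intro ereal_minus_mono GKdim_A_ge[OF n_pos] GKdim_skew_quot_le)
  also have "\<dots> = pertinency K n"
    by (simp add: pertinency_def GKdim_A_def GKdim_skew_quot_def)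
  finally show ?thesis .
qed

end
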